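(* Let $K$ be a field, $X$ an irreducible quasi-projective $K$-variety, $k\ge1$, and $A\subset\mathbb{Z}_{\ge0}^k\setminus\{0\}$ a subset containing the standard basis vectors $\vec e_1,\dots,\vec e_k$. Let $\phi:\mathcal{M}_K\to R$ be a normed motivic measure. If $Z_X^{\mathrm{Kap}}(t)$ is weakly rational for $\phi$ and the power series $$\frac{\sum_{\vec d\in\mathbb{Z}_{\ge0}^k}[X_A^{\vec d}]\,\mathbf{t}^{\vec d}}{Z_X^{\mathrm{Kap}}(t_1)Z_X^{\mathrm{Kap}}(t_2)\cdots Z_X^{\mathrm{Kap}}(t_k)}=\prod_{x\in X}(1-t_1)(1-t_2)\cdots(1-t_k)\left(1+\sum_{\vec a\in A}\mathbf{t}^{\vec a}\right)$$ converges absolutely (after applying $\phi$ to its coefficients) at $t_1=\cdots=t_k=\mathbb{L}_\phi^{-\dim X}$ to a value $\zeta\in R$, then $$\lim_{\vec d\to\infty}\frac{[X_A^{\vec d}]_\phi}{[\mathrm{Sym}^{\vec d}X]_\phi}=\zeta,$$ where $\vec d\to\infty$ means that each entry goes to $\infty$.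
   Context: $K_0(\mathrm{Var}/K)$ is the free abelian group on isomorphism classes of $K$-varieties modulo $[X_1\sqcup X_2]=[X_1]+[X_2]$ and $[X]=[Y]$ if there is a map $X\to Y$ bijective on points over all algebraically closed fields; $\mathbb{L}=[\mathbb{A}^1]$, $\mathcal{M}_K=K_0(\mathrm{Var}/K)[\mathbb{L}^{-1}]$. $Z_X^{\mathrm{Kap}}(t)=\sum_{j\ge0}[\mathrm{Sym}^jX]t^j\in1+t\mathcal{M}_K[[t]]$. $\mathrm{Sym}^{\vec d}X=\prod_i\mathrm{Sym}^{d_i}X$ and $\mathbf{t}^{\vec d}=\prod_it_i^{d_i}$. $X_A^{\vec d}$ is the space of configurations of finitely many distinct points of $X$ labeled by elements of $A$ with labels summing to $\vec d$ (formal sums $\sum_x\vec a_xx$, $\vec a_x\in A$, $\sum\vec a_x=\vec d$); it is a constructible subset of $\mathrm{Sym}^{\vec d}X$, the disjoint union over partitions $\lambda$ of $\vec d$ into elements of $A$ of the labeled configuration spaces $C^\lambda X$. The product over $x\in X$ is the motivic Euler product, an element of $\mathcal{M}_K[[t_1,\dots,t_k]]$; with constant integer coefficients as here, it is the power with exponent $[X]$ in the power structure on $\mathcal{M}_K$ attached to the Kapranov zeta function (so $\prod_{x\in X}\frac1{1-\mathbf{t}^{\vec a}}=Z_X^{\mathrm{Kap}}(\mathbf{t}^{\vec a})$, multiplicatively), and the displayed equality holds in $\mathcal{M}_K[[t_1,\dots,t_k]]$. A motivic measure is a ring morphism $\phi:\mathcal{M}_K\to R$; write $a_\phi=\phi(a)$.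 It is normed if $R$ is complete for a sub-multiplicative norm $\|\cdot\|$ and $\|\mathbb{L}_\phi^{-1}\|<1$. The $\phi$-radius of convergence of $\sum a_{\vec d}\mathbf{t}^{\vec d}$, $a_{\vec d}\in\mathcal{M}_K$, is $1/\limsup_{\vec d}\|\phi(a_{\vec d})\|^{1/\sum\vec d}$, where $\sum\vec d$ is the sum of the entries. A series $\sum r_{\vec d}$ in $R$ converges absolutely if $\sum\|r_{\vec d}\|<\infty$. $Z_X^{\mathrm{Kap}}(t)$ is weakly rational for $\phi$ if the power series $(1-\mathbb{L}^{\dim X}t)Z_X^{\mathrm{Kap}}(t)$ and its inverse both have $\phi$-radius of convergence strictly larger than $\|\mathbb{L}_\phi^{-\dim X}\|$. The quotient in the limit is considered for $\vec d$ large, when the denominator is invertible in $R$. *)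

theory Defs
  imports
    "HOL-Analysis.Analysis"
    "HOL-Algebra.Algebra"
    "HOL-Algebra.Algebraic_Closure_Type"
    "HOL-Library.Poly_Mapping"
    "HOL-Library.Multiset"
    "HOL-Combinatorics.Permutations"
begin

(* frees the letter X *)
no_notation var (\<open>X\<index>\<close>)

section \<open>Fractions\<close>

text \<open>
  The fraction a/b of a ring A with denominators in a multiplicative set S, as the class of all
  pairs equal to it. Only pairs in Q are admitted: Q is everything for an ordinary localization,
  and the pairs of homogeneous elements of equal degree for a degree-zero homogeneous localization.
\<close>

definition fraction :: "'a ring \<Rightarrow> ('a \<times> 'a) set \<Rightarrow> 'a set \<Rightarrow> 'a \<Rightarrow> 'a \<Rightarrow> ('a \<times> 'a) set" where
  "fraction A Q S a b =
     {(c, d). (c, d) \<in> Q \<and> d \<in> S \<and>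
        (\<exists>u\<in>S. u \<otimes>\<^bsub>A\<^esub> ((a \<otimes>\<^bsub>A\<^esub> d) \<ominus>\<^bsub>A\<^esub> (c \<otimes>\<^bsub>A\<^esub> b)) = \<zero>\<^bsub>A\<^esub>)}"

definition fraction_ring :: "'a ring \<Rightarrow> ('a \<times> 'a) set \<Rightarrow> 'a set \<Rightarrow> ('a \<times> 'a) set ring" where
  "fraction_ring A Q S =
     \<lparr> carrier = {fraction A Q S a b |a b. (a, b) \<in> Q \<and> b \<in> S},
       monoid.mult = (\<lambda>F G. \<Union>(a, b)\<in>F. \<Union>(c, d)\<in>G. fraction A Q S (a \<otimes>\<^bsub>A\<^esub> c) (b \<otimes>\<^bsub>A\<^esub> d)),
       one = fraction A Q S \<one>\<^bsub>A\<^esub> \<one>\<^bsub>A\<^esub>,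
       ring.zero = fraction A Q S \<zero>\<^bsub>A\<^esub> \<one>\<^bsub>A\<^esub>,
       add = (\<lambda>F G. \<Union>(a, b)\<in>F. \<Union>(c, d)\<in>G.
                fraction A Q S ((a \<otimes>\<^bsub>A\<^esub> d) \<oplus>\<^bsub>A\<^esub> (c \<otimes>\<^bsub>A\<^esub> b)) (b \<otimes>\<^bsub>A\<^esub> d)) \<rparr>"

text \<open>The polynomial ring whose variables are the elements of V.\<close>

definition mpoly_ring :: "'x set \<Rightarrow> (('x \<Rightarrow>\<^sub>0 nat) \<Rightarrow>\<^sub>0 'c::comm_ring_1) ring" where
  "mpoly_ring V =
     \<lparr> carrier = {f. \<forall>m\<in>Poly_Mapping.keys f. Poly_Mapping.keys m \<subseteq> V},
       monoid.mult = (*), one = 1, ring.zero = 0, add = (+) \<rparr>"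

definition mpoly_const :: "'c \<Rightarrow> (('x \<Rightarrow>\<^sub>0 nat) \<Rightarrow>\<^sub>0 'c::comm_ring_1)" where
  "mpoly_const c = Poly_Mapping.single 0 c"

definition mpoly_var :: "'x \<Rightarrow> (('x \<Rightarrow>\<^sub>0 nat) \<Rightarrow>\<^sub>0 'c::comm_ring_1)" where
  "mpoly_var x = Poly_Mapping.single (Poly_Mapping.single x 1) 1"

section \<open>Schemes over a field\<close>

text \<open>
  A space with a presheaf of K-algebras, K being the field given by the last type parameter.
  The structure morphism to Spec K is recorded as the equivalent ring homomorphism scal
  from K to the global sections.
\<close>

record ('p, 'a, 'k) kspace =
  spc :: "'p topology"
  sect :: "'p set \<Rightarrow> 'a ring"
  restr :: "'p set \<Rightarrow> 'p set \<Rightarrow> 'a \<Rightarrow> 'a"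
  scal :: "'k \<Rightarrow> 'a"

definition is_ringed :: "('p, 'a, 'k::field) kspace \<Rightarrow> bool" where
  "is_ringed X \<longleftrightarrow>
     (\<forall>U. openin (spc X) U \<longrightarrow> cring (sect X U)) \<and>
     (\<forall>U V. openin (spc X) U \<and> openin (spc X) V \<and> V \<subseteq> U \<longrightarrow>
        restr X U V \<in> ring_hom (sect X U) (sect X V)) \<and>
     (\<forall>U s. openin (spc X) U \<and> s \<in> carrier (sect X U) \<longrightarrow> restr X U U s = s) \<and>
     (\<forall>U V W s. openin (spc X) U \<and> openin (spc X) V \<and> openin (spc X) W \<and> W \<subseteq> V \<and> V \<subseteq> U \<and>
        s \<in> carrier (sect X U) \<longrightarrow> restr X V W (restr X U V s) = restr X U W s) \<and>
     (\<forall>\<U> s t. (\<forall>V\<in>\<U>. openin (spc X) V) \<and>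
        s \<in> carrier (sect X (\<Union>\<U>)) \<and> t \<in> carrier (sect X (\<Union>\<U>)) \<and>
        (\<forall>V\<in>\<U>. restr X (\<Union>\<U>) V s = restr X (\<Union>\<U>) V t) \<longrightarrow> s = t) \<and>
     (\<forall>\<U> \<sigma>. (\<forall>V\<in>\<U>. openin (spc X) V \<and> \<sigma> V \<in> carrier (sect X V)) \<and>
        (\<forall>V\<in>\<U>. \<forall>W\<in>\<U>. restr X V (V \<inter> W) (\<sigma> V) = restr X W (V \<inter> W) (\<sigma> W)) \<longrightarrow>
        (\<exists>s\<in>carrier (sect X (\<Union>\<U>)). \<forall>V\<in>\<U>. restr X (\<Union>\<U>) V s = \<sigma> V)) \<and>
     scal X \<in> ring_hom ring_of_type_algebra (sect X (topspace (spc X)))"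

definition open_sub :: "('p, 'a, 'k) kspace \<Rightarrow> 'p set \<Rightarrow> ('p, 'a, 'k) kspace" where
  "open_sub X U =
     X \<lparr> spc := subtopology (spc X) U,
         scal := (\<lambda>c. restr X (topspace (spc X)) U (scal X c)) \<rparr>"

text \<open>The germ at x of the section s over U is a unit of the stalk.\<close>

definition unit_at :: "('p, 'a, 'k) kspace \<Rightarrow> 'p \<Rightarrow> 'p set \<Rightarrow> 'a \<Rightarrow> bool" where
  "unit_at X x U s \<longleftrightarrow>
     (\<exists>V. openin (spc X) V \<and> x \<in> V \<and> V \<subseteq> U \<and> restr X U V s \<in> Units (sect X V))"

definition preim :: "('p, 'a, 'k) kspace \<Rightarrow> ('p \<Rightarrow> 'q) \<Rightarrow> 'q set \<Rightarrow> 'p set" where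
  "preim X h V = {x \<in> topspace (spc X). h x \<in> V}"

record ('p, 'a, 'q, 'b) mor =
  ptm :: "'p \<Rightarrow> 'q"
  secm :: "'q set \<Rightarrow> 'b \<Rightarrow> 'a"

text \<open>
  Morphisms of locally ringed K-spaces. They are compared with mor_eq, as the underlying functions
  are unconstrained outside the space and outside the rings of sections.
\<close>

definition is_mor ::
    "('p, 'a, 'k) kspace \<Rightarrow> ('q, 'b, 'k) kspace \<Rightarrow> ('p, 'a, 'q, 'b) mor \<Rightarrow> bool" where
  "is_mor X Y f \<longleftrightarrow>
     continuous_map (spc X) (spc Y) (ptm f) \<and>
     (\<forall>V. openin (spc Y) V \<longrightarrow> secm f V \<in> ring_hom (sect Y V) (sect X (preim X (ptm f) V))) \<and>
     (\<forall>V W t. openin (spc Y) V \<and> openin (spc Y) W \<and> W \<subseteq> V \<and> t \<in> carrier (sect Y V) \<longrightarrow>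
        secm f W (restr Y V W t) =
        restr X (preim X (ptm f) V) (preim X (ptm f) W) (secm f V t)) \<and>
     (\<forall>V t x. openin (spc Y) V \<and> t \<in> carrier (sect Y V) \<and> x \<in> preim X (ptm f) V \<and>
        unit_at X x (preim X (ptm f) V) (secm f V t) \<longrightarrow> unit_at Y (ptm f x) V t) \<and>
     (\<forall>c. secm f (topspace (spc Y)) (scal Y c) = scal X c)"

definition mor_eq ::
    "('p, 'a, 'k) kspace \<Rightarrow> ('q, 'b, 'k) kspace \<Rightarrow> ('p, 'a, 'q, 'b) mor \<Rightarrow> ('p, 'a, 'q, 'b) mor \<Rightarrow> bool"
  where
  "mor_eq X Y f g \<longleftrightarrow>
     (\<forall>x\<in>topspace (spc X). ptm f x = ptm g x) \<and>
     (\<forall>V t. openin (spc Y) V \<and> t \<in> carrier (sect Y V) \<longrightarrow> secm f V t = secm g V t)"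

definition mor_id :: "('p, 'a, 'p, 'a) mor" where
  "mor_id = \<lparr> ptm = (\<lambda>x. x), secm = (\<lambda>V t. t) \<rparr>"

text \<open>The composite of f from X to Y and g from Y to Z; the middle space Y is an argument.\<close>

definition mor_comp ::
    "('q, 'b, 'k) kspace \<Rightarrow> ('q, 'b, 'r, 'c) mor \<Rightarrow> ('p, 'a, 'q, 'b) mor \<Rightarrow> ('p, 'a, 'r, 'c) mor" where
  "mor_comp Y g f =
     \<lparr> ptm = ptm g \<circ> ptm f,
       secm = (\<lambda>V t. secm f (preim Y (ptm g) V) (secm g V t)) \<rparr>"

definition isomorphic :: "('p, 'a, 'k) kspace \<Rightarrow> ('q, 'b, 'k) kspace \<Rightarrow> bool" where
  "isomorphic X Y \<longleftrightarrow>
     (\<exists>f g. is_mor X Y f \<and> is_mor Y X g \<and>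
        mor_eq X X (mor_comp Y g f) mor_id \<and> mor_eq Y Y (mor_comp X f g) mor_id)"

text \<open>
  The common construction of Spec and Proj. The points of T are prime ideals of A; a section over U
  is a function on U sending p to an element of the localization at p which is locally a fraction.
\<close>

definition fraction_space ::
    "'a ring \<Rightarrow> ('a \<times> 'a) set \<Rightarrow> 'a set topology \<Rightarrow> ('k \<Rightarrow> 'a) \<Rightarrow>
     ('a set, 'a set \<Rightarrow> ('a \<times> 'a) set, 'k) kspace" where
  "fraction_space A Q T h =
     (let stalk = (\<lambda>p. fraction_ring A Q (carrier A - p)) in
     \<lparr> spc = T,
       sect = (\<lambda>U.
         \<lparr> carrier = {s \<in> extensional U. \<forall>p\<in>U. \<exists>V a b. openin T V \<and> p \<in> V \<and> V \<subseteq> U \<and>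
                         (a, b) \<in> Q \<and> (\<forall>q\<in>V. b \<notin> q \<and> s q = fraction A Q (carrier A - q) a b)},
           monoid.mult = (\<lambda>s t. \<lambda>p\<in>U. s p \<otimes>\<^bsub>stalk p\<^esub> t p),
           one = (\<lambda>p\<in>U. \<one>\<^bsub>stalk p\<^esub>),
           ring.zero = (\<lambda>p\<in>U. \<zero>\<^bsub>stalk p\<^esub>),
           add = (\<lambda>s t. \<lambda>p\<in>U. s p \<oplus>\<^bsub>stalk p\<^esub> t p) \<rparr>),
       restr = (\<lambda>U V s. restrict s V),
       scal = (\<lambda>c. \<lambda>p\<in>topspace T. fraction A Q (carrier A - p) (h c) \<one>\<^bsub>A\<^esub>) \<rparr>)"

definition Spec :: "'a ring \<Rightarrow> ('k \<Rightarrow> 'a) \<Rightarrow> ('a set, 'a set \<Rightarrow> ('a \<times> 'a) set, 'k) kspace" where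
  "Spec A h =
     fraction_space A (carrier A \<times> carrier A)
       (topology_generated_by ((\<lambda>f. {p. primeideal p A \<and> f \<notin> p}) ` carrier A)) h"

type_synonym 'k poly_nat = "(nat \<Rightarrow>\<^sub>0 nat) \<Rightarrow>\<^sub>0 'k"

definition affine_line ::
    "('k poly_nat set, 'k poly_nat set \<Rightarrow> ('k poly_nat \<times> 'k poly_nat) set, 'k::field) kspace" where
  "affine_line = Spec (mpoly_ring {0}) mpoly_const"

definition homogeneous :: "nat \<Rightarrow> 'k::field poly_nat \<Rightarrow> bool" where
  "homogeneous e f \<longleftrightarrow>
     (\<forall>m\<in>Poly_Mapping.keys f. (\<Sum>i\<in>Poly_Mapping.keys m. Poly_Mapping.lookup m i) = e)"

definition proj_points :: "nat \<Rightarrow> 'k::field poly_nat set set" where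
  "proj_points n =
     {p. primeideal p (mpoly_ring {..n}) \<and>
         Idl\<^bsub>mpoly_ring {..n}\<^esub> {f \<in> p. \<exists>e. homogeneous e f} = p \<and>
         \<not> mpoly_var ` {..n} \<subseteq> p}"

definition projective_space ::
    "nat \<Rightarrow> ('k poly_nat set, 'k poly_nat set \<Rightarrow> ('k poly_nat \<times> 'k poly_nat) set, 'k::field) kspace" where
  "projective_space n =
     (let A = mpoly_ring {..n} in
      fraction_space A
        {(a, b). a \<in> carrier A \<and> b \<in> carrier A \<and> (\<exists>e. homogeneous e a \<and> homogeneous e b)}
        (topology_generated_by ((\<lambda>f. {p \<in> proj_points n. f \<notin> p}) ` carrier A))
        mpoly_const)"

definition is_affine :: "('p, 'a, 'k::field) kspace \<Rightarrow> bool" where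
  "is_affine X \<longleftrightarrow> isomorphic X (Spec (sect X (topspace (spc X))) (scal X))"

definition is_scheme :: "('p, 'a, 'k::field) kspace \<Rightarrow> bool" where
  "is_scheme X \<longleftrightarrow>
     is_ringed X \<and>
     (\<forall>x\<in>topspace (spc X). \<exists>U. openin (spc X) U \<and> x \<in> U \<and> is_affine (open_sub X U))"

definition finite_type :: "('p, 'a, 'k::field) kspace \<Rightarrow> bool" where
  "finite_type X \<longleftrightarrow>
     (\<exists>\<U>. finite \<U> \<and> \<Union>\<U> = topspace (spc X) \<and>
        (\<forall>U\<in>\<U>. openin (spc X) U \<and> is_affine (open_sub X U) \<and>
           (\<exists>E. finite E \<and> E \<subseteq> carrier (sect X U) \<and>
              generate_ring (sect X U) (E \<union> range (scal (open_sub X U))) = carrier (sect X U))))"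

text \<open>
  A K-variety has at most max(|K|, \<open>\<aleph>\<^sub>0\<close>) points, and as many sections over each open set, so up to
  isomorphism its points and sections can be taken in the type of lists over K. Varieties, the
  test objects of universal properties, and the field extensions of K below live in this universe.
\<close>

type_synonym 'k uspace = "('k list, 'k list, 'k) kspace"

text \<open>Fibre products over K of a family indexed by I; for I empty this is Spec K.\<close>

definition is_product ::
    "'i set \<Rightarrow> ('i \<Rightarrow> 'k::field uspace) \<Rightarrow> 'k uspace \<Rightarrow>
     ('i \<Rightarrow> ('k list, 'k list, 'k list, 'k list) mor) \<Rightarrow> bool" where
  "is_product I Xs P pr \<longleftrightarrow>
     is_scheme P \<and> (\<forall>i\<in>I. is_mor P (Xs i) (pr i)) \<and>
     (\<forall>(T::'k uspace) fs. is_scheme T \<and> (\<forall>i\<in>I. is_mor T (Xs i) (fs i)) \<longrightarrow>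
        (\<exists>g. is_mor T P g \<and> (\<forall>i\<in>I. mor_eq T (Xs i) (mor_comp P (pr i) g) (fs i)) \<and>
           (\<forall>g'. is_mor T P g' \<and> (\<forall>i\<in>I. mor_eq T (Xs i) (mor_comp P (pr i) g') (fs i)) \<longrightarrow>
              mor_eq T P g' g)))"

text \<open>The diagonal has closed image.\<close>

definition separated :: "'k::field uspace \<Rightarrow> bool" where
  "separated X \<longleftrightarrow>
     (\<forall>P pr \<Delta>. is_product {..<2::nat} (\<lambda>_. X) P pr \<and> is_mor X P \<Delta> \<and>
        (\<forall>i<2. mor_eq X X (mor_comp P (pr i) \<Delta>) mor_id) \<longrightarrow>
        closedin (spc P) (ptm \<Delta> ` topspace (spc X)))"

definition variety :: "'k::field uspace \<Rightarrow> bool" where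
  "variety X \<longleftrightarrow> is_scheme X \<and> separated X \<and> finite_type X"

definition irreducible_subset :: "'p topology \<Rightarrow> 'p set \<Rightarrow> bool" where
  "irreducible_subset T S \<longleftrightarrow>
     S \<subseteq> topspace T \<and> S \<noteq> {} \<and>
     (\<forall>C D. closedin T C \<and> closedin T D \<and> S \<subseteq> C \<union> D \<longrightarrow> S \<subseteq> C \<or> S \<subseteq> D)"

definition irreducible_space :: "('p, 'a, 'k) kspace \<Rightarrow> bool" where
  "irreducible_space X \<longleftrightarrow> irreducible_subset (spc X) (topspace (spc X))"

definition krull_dim :: "('p, 'a, 'k) kspace \<Rightarrow> nat" where
  "krull_dim X =
     Sup {n. \<exists>Z. (\<forall>i\<le>n. closedin (spc X) (Z i) \<and> irreducible_subset (spc X) (Z i)) \<and>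
                (\<forall>i<n. Z i \<subset> Z (Suc i))}"

text \<open>
  Immersions: homeomorphisms onto a locally closed subset which are surjective on stalks.
\<close>

definition is_immersion ::
    "('p, 'a, 'k) kspace \<Rightarrow> ('q, 'b, 'k) kspace \<Rightarrow> ('p, 'a, 'q, 'b) mor \<Rightarrow> bool" where
  "is_immersion X Y f \<longleftrightarrow>
     is_mor X Y f \<and> embedding_map (spc X) (spc Y) (ptm f) \<and>
     (\<exists>U C. openin (spc Y) U \<and> closedin (spc Y) C \<and> ptm f ` topspace (spc X) = U \<inter> C) \<and>
     (\<forall>U s x. openin (spc X) U \<and> s \<in> carrier (sect X U) \<and> x \<in> U \<longrightarrow>
        (\<exists>V t W. openin (spc Y) V \<and> ptm f x \<in> V \<and> t \<in> carrier (sect Y V) \<and>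
           openin (spc X) W \<and> x \<in> W \<and> W \<subseteq> U \<inter> preim X (ptm f) V \<and>
           restr X (preim X (ptm f) V) W (secm f V t) = restr X U W s))"

definition quasi_projective :: "('p, 'a, 'k::field) kspace \<Rightarrow> bool" where
  "quasi_projective X \<longleftrightarrow> (\<exists>n f. is_immersion X (projective_space n) f)"

section \<open>The Grothendieck ring of varieties\<close>

text \<open>
  The map induced by f on points over every algebraically closed field is bijective. A point of X
  over L is a morphism from Spec L, so it determines the embedding h of K into L.
\<close>

definition bijective_on_geometric_points ::
    "'k::field uspace \<Rightarrow> 'k uspace \<Rightarrow> ('k list, 'k list, 'k list, 'k list) mor \<Rightarrow> bool" where
  "bijective_on_geometric_points X Y f \<longleftrightarrow>
     (\<forall>(L :: 'k list ring) h. algebraically_closed L \<and> h \<in> ring_hom ring_of_type_algebra L \<longrightarrow>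
        (\<forall>y. is_mor (Spec L h) Y y \<longrightarrow>
           (\<exists>x. is_mor (Spec L h) X x \<and> mor_eq (Spec L h) Y (mor_comp X f x) y \<and>
              (\<forall>x'. is_mor (Spec L h) X x' \<and> mor_eq (Spec L h) Y (mor_comp X f x') y \<longrightarrow>
                 mor_eq (Spec L h) X x' x))))"

definition iso_class :: "('p, 'a, 'k::field) kspace \<Rightarrow> 'k uspace set" where
  "iso_class X = {Y. variety Y \<and> isomorphic Y X}"

definition iso_classes :: "'k::field uspace set set" where
  "iso_classes = iso_class ` {X :: 'k uspace. variety X}"

definition is_disjoint_union :: "'i set \<Rightarrow> ('i \<Rightarrow> ('q, 'b, 'k) kspace) \<Rightarrow> ('p, 'a, 'k) kspace \<Rightarrow> bool"
  where
  "is_disjoint_union I Xs W \<longleftrightarrow>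
     (\<exists>U. (\<forall>i\<in>I. openin (spc W) (U i)) \<and> disjoint_family_on U I \<and>
        (\<Union>i\<in>I. U i) = topspace (spc W) \<and> (\<forall>i\<in>I. isomorphic (open_sub W (U i)) (Xs i)))"

type_synonym 'k k0_free = "('k uspace set \<Rightarrow>\<^sub>0 nat) \<Rightarrow>\<^sub>0 int"
type_synonym 'k k0 = "'k k0_free set"
type_synonym 'k mk = "('k k0 \<times> 'k k0) set"

definition scissor_rels :: "'k::field k0_free set" where
  "scissor_rels =
     {mpoly_var (iso_class W) - (mpoly_var (iso_class X1) + mpoly_var (iso_class X2)) |W X1 X2.
        variety (W :: 'k uspace) \<and> variety (X1 :: 'k uspace) \<and> variety (X2 :: 'k uspace) \<and>
        is_disjoint_union UNIV (\<lambda>b. if b then X1 else X2) W}"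

definition geometric_bijection_rels :: "'k::field k0_free set" where
  "geometric_bijection_rels =
     {mpoly_var (iso_class X) - mpoly_var (iso_class Y) |X Y.
        variety (X :: 'k uspace) \<and> variety (Y :: 'k uspace) \<and>
        (\<exists>f. is_mor X Y f \<and> bijective_on_geometric_points X Y f)}"

definition product_rels :: "'k::field k0_free set" where
  "product_rels =
     {mpoly_var (iso_class P) - (\<Prod>i<n. mpoly_var (iso_class (Xs i))) |P (n::nat) Xs.
        variety (P :: 'k uspace) \<and> (\<forall>i<n. variety (Xs i :: 'k uspace)) \<and>
        (\<exists>pr. is_product {..<n} Xs P pr)}"

text \<open>
  The free abelian group on isomorphism classes modulo the first two families of relations, with
  multiplication given by the product of varieties. It is presented as a ring: products of generators
  are formal at first, and the third family identifies them with the classes of the products of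
  varieties (the case n = 0 makes the class of Spec K the unit). By the third family every
  formal product is again a generator, so the underlying group is the one just described.
\<close>

definition K0_Var :: "'k::field k0 ring" where
  "K0_Var =
     (let R = (mpoly_ring iso_classes :: 'k k0_free ring) in
      R Quot (Idl\<^bsub>R\<^esub> (scissor_rels \<union> geometric_bijection_rels \<union> product_rels)))"

text \<open>The value zero on spaces not isomorphic to a variety is a dummy.\<close>

definition k0_class :: "('p, 'a, 'k::field) kspace \<Rightarrow> 'k k0" where
  "k0_class X =
     (let R = (mpoly_ring iso_classes :: 'k k0_free ring) in
      if iso_class X \<in> iso_classes
      then Idl\<^bsub>R\<^esub> (scissor_rels \<union> geometric_bijection_rels \<union> product_rels) +>\<^bsub>R\<^esub> mpoly_var (iso_class X)
      else \<zero>\<^bsub>K0_Var\<^esub>)"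

definition lefschetz_powers :: "'k::field k0 set" where
  "lefschetz_powers = range (\<lambda>n::nat. k0_class affine_line [^]\<^bsub>K0_Var\<^esub> n)"

definition mk_frac :: "'k::field k0 \<Rightarrow> 'k k0 \<Rightarrow> 'k mk" where
  "mk_frac a b = fraction K0_Var (carrier K0_Var \<times> carrier K0_Var) lefschetz_powers a b"

definition MK :: "'k::field mk ring" where
  "MK = fraction_ring K0_Var (carrier K0_Var \<times> carrier K0_Var) lefschetz_powers"

definition mk_class :: "('p, 'a, 'k::field) kspace \<Rightarrow> 'k mk" where
  "mk_class X = mk_frac (k0_class X) \<one>\<^bsub>K0_Var\<^esub>"

definition lefschetz :: "'k::field mk" where
  "lefschetz = mk_class affine_line"

definition lefschetz_inv :: "'k::field mk" where
  "lefschetz_inv = mk_frac \<one>\<^bsub>K0_Var\<^esub> (k0_class affine_line)"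

section \<open>Symmetric powers and labelled configuration spaces\<close>

text \<open>Y is the quotient of X by the group G of automorphisms, with quotient map f.\<close>

definition is_quotient ::
    "('p, 'a, 'k) kspace \<Rightarrow> ('p, 'a, 'p, 'a) mor set \<Rightarrow> ('p, 'a, 'q, 'b) mor \<Rightarrow>
     ('q, 'b, 'k) kspace \<Rightarrow> bool" where
  "is_quotient X G f Y \<longleftrightarrow>
     is_mor X Y f \<and> quotient_map (spc X) (spc Y) (ptm f) \<and>
     (\<forall>x\<in>topspace (spc X). \<forall>x'\<in>topspace (spc X). ptm f x = ptm f x' \<longleftrightarrow> (\<exists>g\<in>G. ptm g x = x')) \<and>
     (\<forall>V. openin (spc Y) V \<longrightarrow>
        bij_betw (secm f V) (carrier (sect Y V))
          {s \<in> carrier (sect X (preim X (ptm f) V)). \<forall>g\<in>G. secm g (preim X (ptm f) V) s = s})"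

text \<open>The automorphisms of a power P of X permuting the coordinates by elements of H.\<close>

definition coordinate_perms ::
    "'k::field uspace \<Rightarrow> nat \<Rightarrow> 'k uspace \<Rightarrow> (nat \<Rightarrow> ('k list, 'k list, 'k list, 'k list) mor) \<Rightarrow>
     (nat \<Rightarrow> nat) set \<Rightarrow> ('k list, 'k list, 'k list, 'k list) mor set" where
  "coordinate_perms X n P pr H =
     {g. is_mor P P g \<and>
         (\<exists>\<sigma>\<in>H. \<forall>i<n. mor_eq P X (mor_comp P (pr i) g) (pr (\<sigma> i)))}"

definition is_symmetric_power :: "'k::field uspace \<Rightarrow> nat \<Rightarrow> 'k uspace \<Rightarrow> bool" where
  "is_symmetric_power X n Y \<longleftrightarrow>
     variety Y \<and>
     (\<exists>P pr f. is_product {..<n} (\<lambda>_. X) P pr \<and>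
        is_quotient P (coordinate_perms X n P pr {\<sigma>. \<sigma> permutes {..<n}}) f Y)"

text \<open>
  The union of the loci where two coordinates coincide. Two coordinates having the same image point
  is a weaker condition on a point of a scheme, so the loci are given by images of morphisms.
\<close>

definition big_diagonal ::
    "'k::field uspace \<Rightarrow> nat \<Rightarrow> 'k uspace \<Rightarrow> (nat \<Rightarrow> ('k list, 'k list, 'k list, 'k list) mor) \<Rightarrow>
     'k list set" where
  "big_diagonal X n P pr =
     {z. \<exists>i<n. \<exists>j<n. i \<noteq> j \<and>
        (\<exists>(T :: 'k uspace) h. is_scheme T \<and> is_mor T P h \<and>
           mor_eq T X (mor_comp P (pr i) h) (mor_comp P (pr j) h) \<and>
           z \<in> ptm h ` topspace (spc T))}"

text \<open>
  C is the space of configurations of distinct points of X whose labels form the multiset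
  \<open>\<lambda>\<close>: number the points, remove the big diagonal, and divide by label-preserving renumberings.
\<close>

definition is_labelled_conf ::
    "'k::field uspace \<Rightarrow> 'l multiset \<Rightarrow> ('p, 'a, 'k) kspace \<Rightarrow> bool" where
  "is_labelled_conf X lam C \<longleftrightarrow>
     (\<exists>ls P pr f. mset ls = lam \<and> is_product {..<length ls} (\<lambda>_. X) P pr \<and>
        is_quotient
          (open_sub P (topspace (spc P) - big_diagonal X (length ls) P pr))
          (coordinate_perms X (length ls) P pr
             {\<sigma>. \<sigma> permutes {..<length ls} \<and> (\<forall>i<length ls. ls ! \<sigma> i = ls ! i)})
          f C)"

definition vector_partitions :: "('n \<Rightarrow> nat) set \<Rightarrow> ('n \<Rightarrow> nat) \<Rightarrow> ('n \<Rightarrow> nat) multiset set" where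
  "vector_partitions A d = {lam. set_mset lam \<subseteq> A \<and> (\<forall>i. (\<Sum>a\<in>#lam. a i) = d i)}"

text \<open>
  W is the space of configurations of X with labels in A summing to d: the disjoint union,
  over the partitions of d into elements of A, of the labelled configuration spaces.
\<close>

definition is_config_space ::
    "'k::field uspace \<Rightarrow> ('n \<Rightarrow> nat) set \<Rightarrow> ('n \<Rightarrow> nat) \<Rightarrow> 'k uspace \<Rightarrow> bool" where
  "is_config_space X A d W \<longleftrightarrow>
     variety W \<and>
     (\<exists>C :: ('n \<Rightarrow> nat) multiset \<Rightarrow> 'k uspace.
        (\<forall>lam\<in>vector_partitions A d. is_labelled_conf X lam (C lam)) \<and>
        is_disjoint_union (vector_partitions A d) C W)"

section \<open>Power series\<close>

text \<open>Power series over R in variables indexed by a finite type, as families of coefficients.\<close>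

definition power_series_ring :: "'a ring \<Rightarrow> (('n::finite \<Rightarrow> nat) \<Rightarrow> 'a) ring" where
  "power_series_ring R =
     \<lparr> carrier = {f. \<forall>d. f d \<in> carrier R},
       monoid.mult = (\<lambda>f g d. \<Oplus>\<^bsub>R\<^esub>e\<in>{e. \<forall>i. e i \<le> d i}. f e \<otimes>\<^bsub>R\<^esub> g (\<lambda>i. d i - e i)),
       one = (\<lambda>d. if \<forall>i. d i = 0 then \<one>\<^bsub>R\<^esub> else \<zero>\<^bsub>R\<^esub>),
       ring.zero = (\<lambda>d. \<zero>\<^bsub>R\<^esub>),
       add = (\<lambda>f g d. f d \<oplus>\<^bsub>R\<^esub> g d) \<rparr>"

text \<open>The series with coefficients z in the single variable of index i.\<close>

definition series_in :: "'a ring \<Rightarrow> 'n::finite \<Rightarrow> (nat \<Rightarrow> 'a) \<Rightarrow> ('n \<Rightarrow> nat) \<Rightarrow> 'a" where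
  "series_in R i z = (\<lambda>d. if \<forall>j. j \<noteq> i \<longrightarrow> d j = 0 then z (d i) else \<zero>\<^bsub>R\<^esub>)"

section \<open>Normed motivic measures\<close>

definition complete_ring_norm :: "('r::comm_ring_1 \<Rightarrow> real) \<Rightarrow> bool" where
  "complete_ring_norm nrm \<longleftrightarrow>
     (\<forall>x. nrm x \<ge> 0) \<and> (\<forall>x. nrm x = 0 \<longleftrightarrow> x = 0) \<and> (\<forall>x. nrm (- x) = nrm x) \<and>
     (\<forall>x y. nrm (x + y) \<le> nrm x + nrm y) \<and> (\<forall>x y. nrm (x * y) \<le> nrm x * nrm y) \<and>
     Metric_space.mcomplete UNIV (\<lambda>x y. nrm (x - y))"

definition motivic_measure :: "('k::field mk \<Rightarrow> 'r::comm_ring_1) \<Rightarrow> bool" where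
  "motivic_measure \<phi> \<longleftrightarrow> \<phi> \<in> ring_hom MK ring_of_type_algebra"

definition normed_motivic_measure ::
    "('k::field mk \<Rightarrow> 'r::comm_ring_1) \<Rightarrow> ('r \<Rightarrow> real) \<Rightarrow> bool" where
  "normed_motivic_measure \<phi> nrm \<longleftrightarrow>
     motivic_measure \<phi> \<and> complete_ring_norm nrm \<and> nrm (\<phi> lefschetz_inv) < 1"

definition radius ::
    "('k::field mk \<Rightarrow> 'r::comm_ring_1) \<Rightarrow> ('r \<Rightarrow> real) \<Rightarrow> (('n::finite \<Rightarrow> nat) \<Rightarrow> 'k mk) \<Rightarrow> ereal" where
  "radius \<phi> nrm a =
     1 / Limsup cofinite (\<lambda>d. ereal (root (\<Sum>i\<in>UNIV. d i) (nrm (\<phi> (a d)))))"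

text \<open>
  Weak rationality of the zeta function with coefficients z of a variety of dimension n. The single
  variable t is indexed by the unit type.
\<close>

definition weakly_rational ::
    "('k::field mk \<Rightarrow> 'r::comm_ring_1) \<Rightarrow> ('r \<Rightarrow> real) \<Rightarrow> nat \<Rightarrow> (nat \<Rightarrow> 'k mk) \<Rightarrow> bool" where
  "weakly_rational \<phi> nrm n z \<longleftrightarrow>
     (let PS = (power_series_ring MK :: ((unit \<Rightarrow> nat) \<Rightarrow> 'k mk) ring);
          linear_factor = series_in MK () (\<lambda>j. if j = 0 then \<one>\<^bsub>MK\<^esub>
            else if j = 1 then \<ominus>\<^bsub>MK\<^esub> (lefschetz [^]\<^bsub>MK\<^esub> n) else \<zero>\<^bsub>MK\<^esub>);
          B = linear_factor \<otimes>\<^bsub>PS\<^esub> series_in MK () z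
      in \<exists>G\<in>carrier PS. B \<otimes>\<^bsub>PS\<^esub> G = \<one>\<^bsub>PS\<^esub> \<and>
           radius \<phi> nrm B > ereal (nrm (\<phi> lefschetz_inv ^ n)) \<and>
           radius \<phi> nrm G > ereal (nrm (\<phi> lefschetz_inv ^ n)))"

definition converges_absolutely_to :: "('r::comm_ring_1 \<Rightarrow> real) \<Rightarrow> ('i \<Rightarrow> 'r) \<Rightarrow> 'r \<Rightarrow> bool" where
  "converges_absolutely_to nrm r s \<longleftrightarrow>
     (\<lambda>i. nrm (r i)) summable_on UNIV \<and>
     (\<forall>\<epsilon>>0. \<exists>D. finite D \<and> (\<forall>E. finite E \<and> D \<subseteq> E \<longrightarrow> nrm (sum r E - s) < \<epsilon>))"

text \<open>
  The quotients num d / den d tend to s as every entry of d tends to infinity; this includes that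
  den d is invertible once all entries of d are large.
\<close>

definition quotients_tend_to ::
    "('r::comm_ring_1 \<Rightarrow> real) \<Rightarrow> (('n::finite \<Rightarrow> nat) \<Rightarrow> 'r) \<Rightarrow> (('n \<Rightarrow> nat) \<Rightarrow> 'r) \<Rightarrow> 'r \<Rightarrow> bool"
  where
  "quotients_tend_to nrm num den s \<longleftrightarrow>
     (\<forall>\<epsilon>>0. \<exists>N. \<forall>d. (\<forall>i. d i \<ge> N) \<longrightarrow> (\<exists>r. den d * r = 1 \<and> nrm (num d * r - s) < \<epsilon>))"

end

theory Submission
  imports Defs
begin

text \<open>
  Put u for the image of the inverse of the Lefschetz motive to the power dim X, and z j for the image
  of the class of the j-th symmetric power. The numbers z j * u ^ j are the partial sums of the series
  (1 - L^dim X t) Z(t) at t = u. By weak rationality they converge, and the limit \<open>\<beta>\<close> is a unit,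
  its inverse being the value of the inverse series. The class of the configuration space, multiplied
  by the appropriate power of u, is the convolution of the absolutely convergent series for
  \<open>\<zeta>\<close> with products of the bounded convergent sequences z j * u ^ j, so it tends to
  \<open>\<zeta>\<close> times a power of \<open>\<beta>\<close> (Tannery's theorem); the class of the
  symmetric power, multiplied by the same power of u, tends to that power of \<open>\<beta>\<close>.
\<close>

section \<open>Localization of commutative rings\<close>

text \<open>The weights u^|d| are forced by the shape of the convolution: [X_A^d] is the sum over e
  \<le> d of F_e times the product of the z (d_i - e_i), and u^|d| = u^|e| u^|d-e| gives each factor
  its own share. The factor 1 - L^dim X t makes the weighted z j converge because L^dim X u = 1: at
  t = u its product with Z(t) has the differences of consecutive z j u^j as terms. The norm is only
  sub-multiplicative, its value at 1 may exceed 1, and no class of a symmetric power is known to be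
  invertible beforehand. Division is therefore postponed to the end: a weighted denominator close to
  the unit \<beta> is inverted by a geometric series, whose norm is bounded uniformly. The class
  ring is a record built from cosets and fraction classes. It has to be recognised as a commutative
  ring first; only then does \<phi> carry its identities over to \<open>R\<close>, where all the
  analysis takes place.\<close>

locale denominators = cring A for A :: "'a ring" (structure) +
  fixes S :: "'a set"
  assumes S_carrier: "S \<subseteq> carrier A"
    and one_in_S: "\<one> \<in> S"
    and S_mult_closed: "\<lbrakk>a \<in> S; b \<in> S\<rbrakk> \<Longrightarrow> a \<otimes> b \<in> S"
begin

abbreviation frac :: "'a \<Rightarrow> 'a \<Rightarrow> ('a \<times> 'a) set" where
  "frac \<equiv> fraction A (carrier A \<times> carrier A) S"

abbreviation loc :: "('a \<times> 'a) set ring" where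
  "loc \<equiv> fraction_ring A (carrier A \<times> carrier A) S"

lemma S_closed: "s \<in> S \<Longrightarrow> s \<in> carrier A"
  using S_carrier by blast

lemma mem_frac_iff:
  "(c, d) \<in> frac a b \<longleftrightarrow> c \<in> carrier A \<and> d \<in> S \<and> (\<exists>u\<in>S. u \<otimes> (a \<otimes> d \<ominus> c \<otimes> b) = \<zero>)"
  using S_closed by (auto simp: fraction_def)

lemma frac_self: "\<lbrakk>a \<in> carrier A; b \<in> S\<rbrakk> \<Longrightarrow> (a, b) \<in> frac a b"
  using one_in_S S_closed by (auto simp: mem_frac_iff minus_eq r_neg intro!: bexI[of _ "\<one>"])

lemma frac_related_sym:
  assumes "(c, d) \<in> frac a b" "a \<in> carrier A" "b \<in> S"
  shows "(a, b) \<in> frac c d"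
proof -
  obtain u where u: "u \<in> S" "u \<otimes> (a \<otimes> d \<ominus> c \<otimes> b) = \<zero>" and cd: "c \<in> carrier A" "d \<in> S"
    using assms(1) by (auto simp: mem_frac_iff)
  have "u \<otimes> (c \<otimes> b \<ominus> a \<otimes> d) = \<ominus> (u \<otimes> (a \<otimes> d \<ominus> c \<otimes> b))"
    using u(1)[THEN S_closed] cd(1) cd(2)[THEN S_closed] assms(2) assms(3)[THEN S_closed] by algebra
  also have "\<dots> = \<zero>"
    by (simp add: u)
  finally have "u \<otimes> (c \<otimes> b \<ominus> a \<otimes> d) = \<zero>" .
  then show ?thesis
    using u cd assms(2,3) by (auto simp: mem_frac_iff)
qed

text \<open>Elements of \<open>S\<close> may be zero divisors, so equality of fractions only holds
  after multiplication by some element of \<open>S\<close>. Eliminating \<open>c\<close> from the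
  two relations leaves the middle denominator behind, and the witness becomes
  \<open>u \<otimes> w \<otimes> d\<close>.\<close>

lemma frac_related_trans:
  assumes "(c, d) \<in> frac a b" "(e, f) \<in> frac c d" "a \<in> carrier A" "b \<in> S"
  shows "(e, f) \<in> frac a b"
proof -
  obtain u where u: "u \<in> S" "u \<otimes> (a \<otimes> d \<ominus> c \<otimes> b) = \<zero>" and cd: "c \<in> carrier A" "d \<in> S"
    using assms(1) by (auto simp: mem_frac_iff)
  obtain w where w: "w \<in> S" "w \<otimes> (c \<otimes> f \<ominus> e \<otimes> d) = \<zero>" and ef: "e \<in> carrier A" "f \<in> S"
    using assms(2) by (auto simp: mem_frac_iff)
  note C = u(1)[THEN S_closed] w(1)[THEN S_closed] cd(1) cd(2)[THEN S_closed]
    ef(1) ef(2)[THEN S_closed] assms(3) assms(4)[THEN S_closed]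
  have "(u \<otimes> w \<otimes> d) \<otimes> (a \<otimes> f \<ominus> e \<otimes> b)
      = w \<otimes> f \<otimes> (u \<otimes> (a \<otimes> d \<ominus> c \<otimes> b)) \<oplus> u \<otimes> b \<otimes> (w \<otimes> (c \<otimes> f \<ominus> e \<otimes> d))"
    using C by algebra
  also have "\<dots> = \<zero>"
    using C by (simp add: u w)
  finally show ?thesis
    using u(1) w(1) cd(2) ef S_mult_closed by (auto simp: mem_frac_iff)
qed

lemma frac_eqI:
  assumes "(c, d) \<in> frac a b" "a \<in> carrier A" "b \<in> S"
  shows "frac c d = frac a b"
proof -
  have cd: "c \<in> carrier A" "d \<in> S"
    using assms(1) by (auto simp: mem_frac_iff)
  show ?thesis
    using frac_related_trans[OF assms(1) _ assms(2,3)]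
      frac_related_trans[OF frac_related_sym[OF assms] _ cd] by auto
qed

lemma frac_eq:
  assumes "a \<otimes> d = c \<otimes> b" "a \<in> carrier A" "b \<in> S" "c \<in> carrier A" "d \<in> S"
  shows "frac a b = frac c d"
proof -
  have "(a, b) \<in> frac c d"
    using assms one_in_S S_closed by (auto simp: mem_frac_iff minus_eq r_neg intro!: bexI[of _ "\<one>"])
  then show ?thesis
    using assms by (intro frac_eqI)
qed

text \<open>The operations of \<open>fraction_ring\<close> are unions over all pairs of
  representatives. Once every pair gives the same result the union collapses to it, because each
  class contains at least its own pair.\<close>

lemma frac_UN_eq:
  assumes "a \<in> carrier A" "b \<in> S" "c \<in> carrier A" "d \<in> S"
    and "\<And>a' b' c' d'. (a', b') \<in> frac a b \<Longrightarrow> (c', d') \<in> frac c d \<Longrightarrow> G a' b' c' d' = H"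
  shows "(\<Union>(a', b')\<in>frac a b. \<Union>(c', d')\<in>frac c d. G a' b' c' d') = H"
proof -
  have "(\<Union>(a', b')\<in>frac a b. \<Union>(c', d')\<in>frac c d. G a' b' c' d')
      = (\<Union>x\<in>frac a b. \<Union>y\<in>frac c d. H)"
    using assms(5) by (intro SUP_cong refl) auto
  also have "\<dots> = H"
    using frac_self[OF assms(1,2)] frac_self[OF assms(3,4)] by auto
  finally show ?thesis .
qed

lemma frac_mult:
  assumes "a \<in> carrier A" "b \<in> S" "c \<in> carrier A" "d \<in> S"
  shows "frac a b \<otimes>\<^bsub>loc\<^esub> frac c d = frac (a \<otimes> c) (b \<otimes> d)"
proof -
  have "(\<Union>(a', b')\<in>frac a b. \<Union>(c', d')\<in>frac c d. frac (a' \<otimes> c') (b' \<otimes> d'))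
      = frac (a \<otimes> c) (b \<otimes> d)"
  proof (rule frac_UN_eq[OF assms])
    fix a' b' c' d'
    assume "(a', b') \<in> frac a b" "(c', d') \<in> frac c d"
    then obtain u w where u: "u \<in> S" "u \<otimes> (a \<otimes> b' \<ominus> a' \<otimes> b) = \<zero>"
      and w: "w \<in> S" "w \<otimes> (c \<otimes> d' \<ominus> c' \<otimes> d) = \<zero>"
      and a': "a' \<in> carrier A" "b' \<in> S" "c' \<in> carrier A" "d' \<in> S"
      by (auto simp: mem_frac_iff)
    note C = u(1)[THEN S_closed] w(1)[THEN S_closed] assms(1) assms(2)[THEN S_closed]
      assms(3) assms(4)[THEN S_closed] a'(1) a'(2)[THEN S_closed] a'(3) a'(4)[THEN S_closed]
    \<comment> \<open>One factor is exchanged at a time: first a/b for a'/b', then c/d for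
      c'/d'.\<close>
    have "(u \<otimes> w) \<otimes> (a \<otimes> c \<otimes> (b' \<otimes> d') \<ominus> a' \<otimes> c' \<otimes> (b \<otimes> d))
        = w \<otimes> c \<otimes> d' \<otimes> (u \<otimes> (a \<otimes> b' \<ominus> a' \<otimes> b)) \<oplus>
          u \<otimes> a' \<otimes> b \<otimes> (w \<otimes> (c \<otimes> d' \<ominus> c' \<otimes> d))"
      using C by algebra
    also have "\<dots> = \<zero>"
      using C by (simp add: u w)
    finally have "(a' \<otimes> c', b' \<otimes> d') \<in> frac (a \<otimes> c) (b \<otimes> d)"
      using u(1) w(1) a' S_mult_closed by (auto simp: mem_frac_iff)
    then show "frac (a' \<otimes> c') (b' \<otimes> d') = frac (a \<otimes> c) (b \<otimes> d)"
      using assms S_mult_closed by (intro frac_eqI) auto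
  qed
  then show ?thesis
    by (simp add: fraction_ring_def)
qed

lemma frac_add:
  assumes "a \<in> carrier A" "b \<in> S" "c \<in> carrier A" "d \<in> S"
  shows "frac a b \<oplus>\<^bsub>loc\<^esub> frac c d = frac (a \<otimes> d \<oplus> c \<otimes> b) (b \<otimes> d)"
proof -
  have "(\<Union>(a', b')\<in>frac a b. \<Union>(c', d')\<in>frac c d. frac (a' \<otimes> d' \<oplus> c' \<otimes> b') (b' \<otimes> d'))
      = frac (a \<otimes> d \<oplus> c \<otimes> b) (b \<otimes> d)"
  proof (rule frac_UN_eq[OF assms])
    fix a' b' c' d'
    assume "(a', b') \<in> frac a b" "(c', d') \<in> frac c d"
    then obtain u w where u: "u \<in> S" "u \<otimes> (a \<otimes> b' \<ominus> a' \<otimes> b) = \<zero>"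
      and w: "w \<in> S" "w \<otimes> (c \<otimes> d' \<ominus> c' \<otimes> d) = \<zero>"
      and a': "a' \<in> carrier A" "b' \<in> S" "c' \<in> carrier A" "d' \<in> S"
      by (auto simp: mem_frac_iff)
    note C = u(1)[THEN S_closed] w(1)[THEN S_closed] assms(1) assms(2)[THEN S_closed]
      assms(3) assms(4)[THEN S_closed] a'(1) a'(2)[THEN S_closed] a'(3) a'(4)[THEN S_closed]
    have "(u \<otimes> w) \<otimes> ((a \<otimes> d \<oplus> c \<otimes> b) \<otimes> (b' \<otimes> d') \<ominus> (a' \<otimes> d' \<oplus> c' \<otimes> b') \<otimes> (b \<otimes> d))
        = w \<otimes> d \<otimes> d' \<otimes> (u \<otimes> (a \<otimes> b' \<ominus> a' \<otimes> b)) \<oplus>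
          u \<otimes> b \<otimes> b' \<otimes> (w \<otimes> (c \<otimes> d' \<ominus> c' \<otimes> d))"
      using C by algebra
    also have "\<dots> = \<zero>"
      using C by (simp add: u w)
    finally have "(a' \<otimes> d' \<oplus> c' \<otimes> b', b' \<otimes> d') \<in> frac (a \<otimes> d \<oplus> c \<otimes> b) (b \<otimes> d)"
      using C u(1) w(1) a' S_mult_closed by (auto simp: mem_frac_iff)
    then show "frac (a' \<otimes> d' \<oplus> c' \<otimes> b') (b' \<otimes> d') = frac (a \<otimes> d \<oplus> c \<otimes> b) (b \<otimes> d)"
      using assms C S_mult_closed by (intro frac_eqI) auto
  qed
  then show ?thesis
    by (simp add: fraction_ring_def)
qed

lemma frac_one: "\<one>\<^bsub>loc\<^esub> = frac \<one> \<one>"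
  and frac_zero: "\<zero>\<^bsub>loc\<^esub> = frac \<zero> \<one>"
  by (simp_all add: fraction_ring_def)

lemma carrier_loc: "x \<in> carrier loc \<longleftrightarrow> (\<exists>a\<in>carrier A. \<exists>b\<in>S. x = frac a b)"
  using S_closed by (auto simp: fraction_ring_def)

lemma cring_loc: "cring loc"
proof (rule cringI)
  show "abelian_group loc"
  proof (rule abelian_groupI; (unfold carrier_loc frac_zero)?)
    fix x y z
    assume "\<exists>a\<in>carrier A. \<exists>b\<in>S. x = frac a b" "\<exists>a\<in>carrier A. \<exists>b\<in>S. y = frac a b"
      "\<exists>a\<in>carrier A. \<exists>b\<in>S. z = frac a b"
    then obtain a b c d e f where C: "a \<in> carrier A" "b \<in> S" "c \<in> carrier A" "d \<in> S" "e \<in> carrier A" "f \<in> S"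
      and x: "x = frac a b" "y = frac c d" "z = frac e f"
      by blast
    note C' = C(1,3,5) C(2,4,6)[THEN S_closed]
    have eq: "(a \<otimes> d \<oplus> c \<otimes> b) \<otimes> f \<oplus> e \<otimes> (b \<otimes> d) = a \<otimes> (d \<otimes> f) \<oplus> (c \<otimes> f \<oplus> e \<otimes> d) \<otimes> b"
      using C' by algebra
    have "x \<oplus>\<^bsub>loc\<^esub> y \<oplus>\<^bsub>loc\<^esub> z = frac ((a \<otimes> d \<oplus> c \<otimes> b) \<otimes> f \<oplus> e \<otimes> (b \<otimes> d)) (b \<otimes> d \<otimes> f)"
      unfolding x using C C' by (simp add: frac_add S_mult_closed)
    also have "\<dots> = x \<oplus>\<^bsub>loc\<^esub> (y \<oplus>\<^bsub>loc\<^esub> z)"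
      unfolding x using C C' by (simp add: frac_add S_mult_closed m_assoc eq)
    finally show "x \<oplus>\<^bsub>loc\<^esub> y \<oplus>\<^bsub>loc\<^esub> z = x \<oplus>\<^bsub>loc\<^esub> (y \<oplus>\<^bsub>loc\<^esub> z)" .
  next
    fix x y
    assume "\<exists>a\<in>carrier A. \<exists>b\<in>S. x = frac a b" "\<exists>a\<in>carrier A. \<exists>b\<in>S. y = frac a b"
    then obtain a b c d where C: "a \<in> carrier A" "b \<in> S" "c \<in> carrier A" "d \<in> S"
      and x: "x = frac a b" "y = frac c d"
      by blast
    show "\<exists>a\<in>carrier A. \<exists>b\<in>S. x \<oplus>\<^bsub>loc\<^esub> y = frac a b"
      unfolding x frac_add[OF C]
      using C by (intro bexI[of _ "a \<otimes> d \<oplus> c \<otimes> b"] bexI[of _ "b \<otimes> d"]) (simp_all add: S_closed S_mult_closed)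
    show "x \<oplus>\<^bsub>loc\<^esub> y = y \<oplus>\<^bsub>loc\<^esub> x"
      unfolding x using C by (simp add: frac_add S_closed a_comm m_comm)
  next
    show "\<exists>a\<in>carrier A. \<exists>b\<in>S. frac \<zero> \<one> = frac a b"
      using one_in_S by blast
  next
    fix x
    assume "\<exists>a\<in>carrier A. \<exists>b\<in>S. x = frac a b"
    then obtain a b where C: "a \<in> carrier A" "b \<in> S" and x: "x = frac a b"
      by blast
    show "frac \<zero> \<one> \<oplus>\<^bsub>loc\<^esub> x = x"
      unfolding x using C by (simp add: frac_add one_in_S S_closed)
    have "frac (\<ominus> a) b \<oplus>\<^bsub>loc\<^esub> x = frac (\<ominus> a \<otimes> b \<oplus> a \<otimes> b) (b \<otimes> b)"
      unfolding x using C by (simp add: frac_add)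
    also have "\<dots> = frac \<zero> \<one>"
      using C one_in_S by (intro frac_eq) (auto simp: S_closed S_mult_closed l_minus l_neg)
    finally show "\<exists>y\<in>carrier loc. y \<oplus>\<^bsub>loc\<^esub> x = frac \<zero> \<one>"
      using C by (intro bexI[of _ "frac (\<ominus> a) b"]) (auto simp: carrier_loc)
  qed
next
  show "comm_monoid loc"
  proof (rule comm_monoidI; (unfold carrier_loc frac_one)?)
    fix x y z
    assume "\<exists>a\<in>carrier A. \<exists>b\<in>S. x = frac a b" "\<exists>a\<in>carrier A. \<exists>b\<in>S. y = frac a b"
      "\<exists>a\<in>carrier A. \<exists>b\<in>S. z = frac a b"
    then obtain a b c d e f where C: "a \<in> carrier A" "b \<in> S" "c \<in> carrier A" "d \<in> S" "e \<in> carrier A" "f \<in> S"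
      and x: "x = frac a b" "y = frac c d" "z = frac e f"
      by blast
    show "x \<otimes>\<^bsub>loc\<^esub> y \<otimes>\<^bsub>loc\<^esub> z = x \<otimes>\<^bsub>loc\<^esub> (y \<otimes>\<^bsub>loc\<^esub> z)"
      unfolding x using C by (simp add: frac_mult S_mult_closed S_closed m_assoc)
  next
    fix x y
    assume "\<exists>a\<in>carrier A. \<exists>b\<in>S. x = frac a b" "\<exists>a\<in>carrier A. \<exists>b\<in>S. y = frac a b"
    then obtain a b c d where C: "a \<in> carrier A" "b \<in> S" "c \<in> carrier A" "d \<in> S"
      and x: "x = frac a b" "y = frac c d"
      by blast
    show "\<exists>a\<in>carrier A. \<exists>b\<in>S. x \<otimes>\<^bsub>loc\<^esub> y = frac a b"
      unfolding x frac_mult[OF C]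
      using C by (intro bexI[of _ "a \<otimes> c"] bexI[of _ "b \<otimes> d"]) (simp_all add: S_closed S_mult_closed)
    show "x \<otimes>\<^bsub>loc\<^esub> y = y \<otimes>\<^bsub>loc\<^esub> x"
      unfolding x using C by (simp add: frac_mult S_closed m_comm)
  next
    show "\<exists>a\<in>carrier A. \<exists>b\<in>S. frac \<one> \<one> = frac a b"
      using one_in_S by blast
  next
    fix x
    assume "\<exists>a\<in>carrier A. \<exists>b\<in>S. x = frac a b"
    then show "frac \<one> \<one> \<otimes>\<^bsub>loc\<^esub> x = x"
      by (auto simp: frac_mult one_in_S S_closed)
  qed
next
  fix x y z
  assume "x \<in> carrier loc" "y \<in> carrier loc" "z \<in> carrier loc"
  then obtain a b c d e f where C: "a \<in> carrier A" "b \<in> S" "c \<in> carrier A" "d \<in> S" "e \<in> carrier A" "f \<in> S"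
    and x: "x = frac a b" "y = frac c d" "z = frac e f"
    unfolding carrier_loc by blast
  note C' = C(1,3,5) C(2,4,6)[THEN S_closed]
  \<comment> \<open>Adding the two products brings in the denominator \<open>f\<close> twice, so
    here the fractions agree only after cancelling a common factor \<open>f\<close>.\<close>
  have "frac ((a \<otimes> d \<oplus> c \<otimes> b) \<otimes> e) (b \<otimes> d \<otimes> f)
      = frac (a \<otimes> e \<otimes> (d \<otimes> f) \<oplus> c \<otimes> e \<otimes> (b \<otimes> f)) (b \<otimes> f \<otimes> (d \<otimes> f))"
  proof (rule frac_eq)
    show "(a \<otimes> d \<oplus> c \<otimes> b) \<otimes> e \<otimes> (b \<otimes> f \<otimes> (d \<otimes> f))
        = (a \<otimes> e \<otimes> (d \<otimes> f) \<oplus> c \<otimes> e \<otimes> (b \<otimes> f)) \<otimes> (b \<otimes> d \<otimes> f)"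
      using C' by algebra
  qed (use C' C S_mult_closed in auto)
  then show "(x \<oplus>\<^bsub>loc\<^esub> y) \<otimes>\<^bsub>loc\<^esub> z = x \<otimes>\<^bsub>loc\<^esub> z \<oplus>\<^bsub>loc\<^esub> y \<otimes>\<^bsub>loc\<^esub> z"
    unfolding x using C C' by (simp add: frac_mult frac_add S_mult_closed)
qed

lemma frac_of_ring_hom: "(\<lambda>a. frac a \<one>) \<in> ring_hom A loc"
  using one_in_S
  by (intro ring_hom_memI) (auto simp: frac_mult frac_add frac_one carrier_loc)

lemma frac_inverse:
  assumes "a \<in> S"
  shows "frac a \<one> \<otimes>\<^bsub>loc\<^esub> frac \<one> a = \<one>\<^bsub>loc\<^esub>" "frac \<one> a \<in> carrier loc"
proof -
  show "frac a \<one> \<otimes>\<^bsub>loc\<^esub> frac \<one> a = \<one>\<^bsub>loc\<^esub>"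
    unfolding frac_one using assms one_in_S S_closed
    by (simp add: frac_mult) (intro frac_eq; simp)
qed (use assms in \<open>auto simp: carrier_loc\<close>)

end

section \<open>The Grothendieck ring of varieties\<close>

lemma mpoly_ring_simps:
  "x \<otimes>\<^bsub>mpoly_ring V\<^esub> y = x * y" "x \<oplus>\<^bsub>mpoly_ring V\<^esub> y = x + y"
  "\<one>\<^bsub>mpoly_ring V\<^esub> = 1" "\<zero>\<^bsub>mpoly_ring V\<^esub> = 0"
  by (simp_all add: mpoly_ring_def)

lemma cring_mpoly_ring: "cring (mpoly_ring V :: (('x \<Rightarrow>\<^sub>0 nat) \<Rightarrow>\<^sub>0 'c::comm_ring_1) ring)"
proof (rule cringI)
  let ?R = "mpoly_ring V :: (('x \<Rightarrow>\<^sub>0 nat) \<Rightarrow>\<^sub>0 'c) ring"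
  have add: "f + g \<in> carrier ?R" if "f \<in> carrier ?R" "g \<in> carrier ?R" for f g
    using that keys_add[of f g] by (auto simp: mpoly_ring_def)
  have mult: "f * g \<in> carrier ?R" if fg: "f \<in> carrier ?R" "g \<in> carrier ?R" for f g
  proof -
    have "Poly_Mapping.keys m \<subseteq> V" if m: "m \<in> Poly_Mapping.keys (f * g)" for m
    proof -
      obtain a b where "m = a + b" "a \<in> Poly_Mapping.keys f" "b \<in> Poly_Mapping.keys g"
        using keys_mult[of f g] m by blast
      then show ?thesis
        using fg keys_add[of a b] by (force simp: mpoly_ring_def)
    qed
    then show ?thesis by (simp add: mpoly_ring_def)
  qed
  have zero: "0 \<in> carrier ?R" and one: "1 \<in> carrier ?R"
    by (simp_all add: mpoly_ring_def)
  have uminus: "- f \<in> carrier ?R" if "f \<in> carrier ?R" for f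
    using that by (simp add: mpoly_ring_def keys_def)
  show "abelian_group ?R"
  proof (rule abelian_groupI; (unfold mpoly_ring_simps)?)
    fix f assume "f \<in> carrier ?R"
    then show "\<exists>g\<in>carrier ?R. g + f = 0"
      using uminus by (intro bexI[of _ "- f"]) simp_all
  qed (use add zero in \<open>simp_all only: add.assoc add.commute add.left_commute add_0_left add_0_right\<close>)
  show "comm_monoid ?R"
    by (rule comm_monoidI; (unfold mpoly_ring_simps)?)
      (use mult one in \<open>simp_all only: mult.assoc mult.commute mult.left_commute mult_1_left mult_1_right\<close>)
qed (simp only: mpoly_ring_simps distrib_right)

text \<open>The relations of the Grothendieck ring use the subtraction of the polynomial type,
  cosets use that of the ring record. The latter goes through an inverse chosen in the carrier; the
  two agree because adding \<open>g\<close> back gives \<open>f\<close> in both cases.\<close>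

lemma mpoly_ring_minus:
  fixes f g :: "('x \<Rightarrow>\<^sub>0 nat) \<Rightarrow>\<^sub>0 'c::comm_ring_1"
  assumes "f \<in> carrier (mpoly_ring V)" "g \<in> carrier (mpoly_ring V)"
  shows "f \<ominus>\<^bsub>mpoly_ring V\<^esub> g = f - g"
proof -
  interpret cring "mpoly_ring V :: (('x \<Rightarrow>\<^sub>0 nat) \<Rightarrow>\<^sub>0 'c::comm_ring_1) ring" by (rule cring_mpoly_ring)
  have "(f \<ominus>\<^bsub>mpoly_ring V\<^esub> g) \<oplus>\<^bsub>mpoly_ring V\<^esub> g = f"
    using assms by (simp add: minus_eq a_assoc l_neg)
  then show ?thesis
    by (simp add: mpoly_ring_simps algebra_simps)
qed

lemma mpoly_var_in_carrier: "x \<in> V \<Longrightarrow> mpoly_var x \<in> carrier (mpoly_ring V)"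
  by (auto simp: mpoly_ring_def mpoly_var_def split: if_splits)

lemma prod_mpoly_var_in_carrier:
  assumes "\<And>i. i \<in> I \<Longrightarrow> x i \<in> V"
  shows "(\<Prod>i\<in>I. mpoly_var (x i)) \<in> carrier (mpoly_ring V :: (('x \<Rightarrow>\<^sub>0 nat) \<Rightarrow>\<^sub>0 'c::comm_ring_1) ring)"
proof -
  interpret cring "mpoly_ring V :: (('x \<Rightarrow>\<^sub>0 nat) \<Rightarrow>\<^sub>0 'c::comm_ring_1) ring" by (rule cring_mpoly_ring)
  show ?thesis
    using assms
  proof (induction I rule: infinite_finite_induct)
    case (insert i I)
    have "mpoly_var (x i) \<otimes>\<^bsub>mpoly_ring V\<^esub> (\<Prod>i\<in>I. mpoly_var (x i)) \<in> carrier (mpoly_ring V :: (('x \<Rightarrow>\<^sub>0 nat) \<Rightarrow>\<^sub>0 'c) ring)"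
      using insert.prems insert.IH by (intro m_closed mpoly_var_in_carrier) simp_all
    then show ?case
      using insert.hyps by (simp add: mpoly_ring_simps(1))
  qed (use one_closed in \<open>simp_all add: mpoly_ring_simps(3)\<close>)
qed

lemma iso_class_in_iso_classes: "variety X \<Longrightarrow> iso_class X \<in> iso_classes"
  by (auto simp: iso_classes_def)

section \<open>The Grothendieck ring as a quotient of a polynomial ring\<close>

abbreviation K0_rels :: "'k::field k0_free set" where
  "K0_rels \<equiv> scissor_rels \<union> geometric_bijection_rels \<union> product_rels"

abbreviation K0_free_ring :: "'k::field k0_free ring" where
  "K0_free_ring \<equiv> mpoly_ring iso_classes"

text \<open>A generated ideal is available only for a subset of the carrier; this holds here because
  the relations mention classes of varieties alone.\<close>

lemma K0_rels_subset: "K0_rels \<subseteq> carrier K0_free_ring"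
proof -
  interpret cring K0_free_ring by (rule cring_mpoly_ring)
  have minus: "f - g \<in> carrier K0_free_ring"
    if "f \<in> carrier K0_free_ring" "g \<in> carrier K0_free_ring" for f g :: "'a k0_free"
    using minus_closed[OF that] that by (simp add: mpoly_ring_minus)
  have plus: "f + g \<in> carrier K0_free_ring"
    if "f \<in> carrier K0_free_ring" "g \<in> carrier K0_free_ring" for f g :: "'a k0_free"
    using a_closed[OF that] by (simp add: mpoly_ring_simps)
  show ?thesis
    unfolding scissor_rels_def geometric_bijection_rels_def product_rels_def
    by (auto intro!: minus plus mpoly_var_in_carrier iso_class_in_iso_classes
        prod_mpoly_var_in_carrier)
qed

lemma ideal_K0_rels: "ideal (Idl\<^bsub>K0_free_ring\<^esub> K0_rels) K0_free_ring"
  using K0_rels_subset cring_mpoly_ring cring.axioms(1) ring.genideal_ideal by blast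

lemma K0_Var_eq: "K0_Var = K0_free_ring Quot (Idl\<^bsub>K0_free_ring\<^esub> K0_rels)"
  by (simp add: K0_Var_def Let_def)

lemma cring_K0_Var: "cring K0_Var"
  unfolding K0_Var_eq by (rule ideal.quotient_is_cring[OF ideal_K0_rels cring_mpoly_ring])

definition K0_proj :: "'k::field k0_free \<Rightarrow> 'k k0" where
  "K0_proj f = Idl\<^bsub>K0_free_ring\<^esub> K0_rels +>\<^bsub>K0_free_ring\<^esub> f"

lemma K0_proj_ring_hom: "K0_proj \<in> ring_hom K0_free_ring K0_Var"
  unfolding K0_Var_eq K0_proj_def by (rule ideal.rcos_ring_hom[OF ideal_K0_rels])

lemma k0_class_variety: "variety X \<Longrightarrow> k0_class X = K0_proj (mpoly_var (iso_class X))"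
  by (simp add: k0_class_def K0_proj_def iso_class_in_iso_classes Let_def)

text \<open>The dummy value zero makes this true of every space, so it applies directly to
  \<open>affine_line\<close>, whose points lie outside the universe of
  \<open>uspace\<close>.\<close>

lemma k0_class_in_carrier:
  fixes X :: "('p, 'a, 'k::field) kspace"
  shows "k0_class X \<in> carrier K0_Var"
proof -
  interpret cring "K0_Var :: 'k k0 ring" by (rule cring_K0_Var)
  show ?thesis
  proof (cases "iso_class X \<in> iso_classes")
    case True
    then have "k0_class X = K0_proj (mpoly_var (iso_class X))"
      by (simp add: k0_class_def K0_proj_def Let_def)
    then show ?thesis
      using ring_hom_closed[OF K0_proj_ring_hom mpoly_var_in_carrier[OF True]] by simp
  next
    case False
    then have "k0_class X = \<zero>\<^bsub>K0_Var\<^esub>"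
      by (simp add: k0_class_def Let_def)
    then show ?thesis by simp
  qed
qed

lemma K0_proj_prod:
  fixes n :: nat
  assumes "variety P" "\<And>i. i < n \<Longrightarrow> variety (Xs i)" "is_product {..<n} Xs P pr"
  shows "K0_proj (mpoly_var (iso_class P)) = K0_proj (\<Prod>i<n. mpoly_var (iso_class (Xs i)))"
proof -
  interpret cring "K0_free_ring :: 'a k0_free ring" by (rule cring_mpoly_ring)
  have C: "mpoly_var (iso_class P) \<in> carrier K0_free_ring"
    "(\<Prod>i<n. mpoly_var (iso_class (Xs i))) \<in> carrier K0_free_ring"
    using assms by (auto intro!: mpoly_var_in_carrier prod_mpoly_var_in_carrier iso_class_in_iso_classes)
  have "mpoly_var (iso_class P) - (\<Prod>i<n. mpoly_var (iso_class (Xs i))) \<in> K0_rels"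
    unfolding product_rels_def
    by (rule UnI2, rule CollectI, rule exI[of _ P], rule exI[of _ n], rule exI[of _ Xs]) (use assms in auto)
  then have "mpoly_var (iso_class P) \<ominus>\<^bsub>K0_free_ring\<^esub> (\<Prod>i<n. mpoly_var (iso_class (Xs i)))
      \<in> Idl\<^bsub>K0_free_ring\<^esub> K0_rels"
    unfolding mpoly_ring_minus[OF C] using genideal_self[OF K0_rels_subset] by (rule rev_subsetD)
  then show ?thesis
    unfolding K0_proj_def by (rule iffD1[OF quotient_eq_iff_same_a_r_cos[OF ideal_K0_rels C]])
qed

section \<open>Inverting the class of the affine line\<close>

lemma denominators_lefschetz_powers: "denominators K0_Var lefschetz_powers"
proof -
  interpret cring "K0_Var :: 'a k0 ring" by (rule cring_K0_Var)
  show ?thesis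
  proof
    show "lefschetz_powers \<subseteq> carrier (K0_Var :: 'a k0 ring)"
      by (auto simp: lefschetz_powers_def k0_class_in_carrier)
    show "\<one>\<^bsub>K0_Var\<^esub> \<in> (lefschetz_powers :: 'a k0 set)"
      unfolding lefschetz_powers_def by (rule range_eqI[of _ _ 0]) simp
    show "a \<otimes>\<^bsub>K0_Var\<^esub> b \<in> lefschetz_powers" if "a \<in> lefschetz_powers" "b \<in> lefschetz_powers"
      for a b :: "'a k0"
      using that by (auto simp: lefschetz_powers_def nat_pow_mult k0_class_in_carrier)
  qed
qed

lemma cring_MK: "cring MK"
  unfolding MK_def by (rule denominators.cring_loc[OF denominators_lefschetz_powers])

lemma mk_frac_ring_hom: "(\<lambda>a. mk_frac a \<one>\<^bsub>K0_Var\<^esub>) \<in> ring_hom K0_Var MK"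
  unfolding MK_def mk_frac_def
  by (rule denominators.frac_of_ring_hom[OF denominators_lefschetz_powers])

lemma mk_class_in_carrier: "mk_class X \<in> carrier MK"
  unfolding mk_class_def by (rule ring_hom_closed[OF mk_frac_ring_hom k0_class_in_carrier])

lemma lefschetz_inverse:
  shows "(lefschetz_inv :: 'k::field mk) \<in> carrier MK"
    and "lefschetz \<otimes>\<^bsub>MK\<^esub> lefschetz_inv = (\<one>\<^bsub>MK\<^esub> :: 'k mk)"
proof -
  interpret cring "K0_Var :: 'k k0 ring" by (rule cring_K0_Var)
  have "k0_class affine_line \<in> (lefschetz_powers :: 'k k0 set)"
    unfolding lefschetz_powers_def
    by (rule range_eqI[of _ _ 1]) (simp add: k0_class_in_carrier)
  note inverse = denominators.frac_inverse[OF denominators_lefschetz_powers this]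
  show "(lefschetz_inv :: 'k mk) \<in> carrier MK"
    using inverse(2) by (simp add: MK_def lefschetz_inv_def mk_frac_def)
  show "lefschetz \<otimes>\<^bsub>MK\<^esub> lefschetz_inv = (\<one>\<^bsub>MK\<^esub> :: 'k mk)"
    using inverse(1) by (simp add: MK_def lefschetz_def lefschetz_inv_def mk_class_def mk_frac_def)
qed

text \<open>The defining relations of the Grothendieck ring only involve products indexed by an initial
  segment of the natural numbers.\<close>

lemma is_product_reindex:
  fixes b :: "'j \<Rightarrow> 'i" and P :: "'k::field uspace"
  assumes "bij_betw b J I" "is_product I Xs P pr"
  shows "is_product J (\<lambda>j. Xs (b j)) P (\<lambda>j. pr (b j))"
proof -
  have I: "(\<forall>i\<in>I. Q i) \<longleftrightarrow> (\<forall>j\<in>J. Q (b j))" for Q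
    using bij_betw_imp_surj_on[OF assms(1)] by blast
  define b' where "b' = inv_into J b"
  have b': "b' (b j) = j" if "j \<in> J" for j
    using that assms(1) by (simp add: b'_def bij_betw_inv_into_left)
  show ?thesis
    unfolding is_product_def
  proof (intro conjI allI impI)
    show "is_scheme P" "\<forall>j\<in>J. is_mor P (Xs (b j)) (pr (b j))"
      using assms(2) by (auto simp: is_product_def I)
  next
    fix T :: "'k uspace" and fs :: "'j \<Rightarrow> ('k list, 'k list, 'k list, 'k list) mor"
    assume T: "is_scheme T \<and> (\<forall>j\<in>J. is_mor T (Xs (b j)) (fs j))"
    then have "is_scheme T \<and> (\<forall>i\<in>I. is_mor T (Xs i) (fs (b' i)))"
      by (simp add: I b')
    then have "\<exists>g. is_mor T P g \<and> (\<forall>i\<in>I. mor_eq T (Xs i) (mor_comp P (pr i) g) (fs (b' i))) \<and>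
        (\<forall>g'. is_mor T P g' \<and> (\<forall>i\<in>I. mor_eq T (Xs i) (mor_comp P (pr i) g') (fs (b' i))) \<longrightarrow>
          mor_eq T P g' g)"
      by (rule conjunct2[OF conjunct2[OF assms(2)[unfolded is_product_def]],
            THEN spec, THEN spec[of _ "\<lambda>i. fs (b' i)"], THEN mp])
    then show "\<exists>g. is_mor T P g \<and> (\<forall>j\<in>J. mor_eq T (Xs (b j)) (mor_comp P (pr (b j)) g) (fs j)) \<and>
        (\<forall>g'. is_mor T P g' \<and> (\<forall>j\<in>J. mor_eq T (Xs (b j)) (mor_comp P (pr (b j)) g') (fs j)) \<longrightarrow>
          mor_eq T P g' g)"
      by (simp add: I b')
  qed
qed

text \<open>\<open>\<psi>\<close> is \<phi> pulled back to the polynomial ring on isomorphism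
  classes, where a product of generators is a formal monomial. \<open>product_rels\<close>
  identifies the class of a product of varieties with such a monomial, and a homomorphism splits
  monomials. The relations number the factors by naturals, hence the enumeration \<open>b\<close> of
  the index type.\<close>

lemma motivic_measure_product:
  fixes \<phi> :: "'k::field mk \<Rightarrow> 'r::comm_ring_1" and Xs :: "'i::finite \<Rightarrow> 'k uspace"
  assumes "motivic_measure \<phi>" "variety P" "\<And>i. variety (Xs i)" "is_product UNIV Xs P pr"
  shows "\<phi> (mk_class P) = (\<Prod>i\<in>UNIV. \<phi> (mk_class (Xs i)))"
proof -
  define \<psi> where "\<psi> f = \<phi> (mk_frac (K0_proj f) \<one>\<^bsub>K0_Var\<^esub>)" for f
  have "(\<lambda>f. mk_frac (K0_proj f) \<one>\<^bsub>K0_Var\<^esub>) \<in> ring_hom K0_free_ring MK"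
    using ring_hom_trans[OF K0_proj_ring_hom mk_frac_ring_hom] by (simp add: comp_def)
  then have "\<phi> \<circ> (\<lambda>f. mk_frac (K0_proj f) \<one>\<^bsub>K0_Var\<^esub>) \<in> ring_hom K0_free_ring ring_of_type_algebra"
    using assms(1) unfolding motivic_measure_def by (rule ring_hom_trans)
  then have \<psi>: "\<psi> \<in> ring_hom K0_free_ring ring_of_type_algebra"
    by (simp add: \<psi>_def[abs_def] comp_def)
  have class_eq: "\<phi> (mk_class Y) = \<psi> (mpoly_var (iso_class Y))" if "variety Y" for Y :: "'k uspace"
    using that by (simp add: mk_class_def \<psi>_def k0_class_variety)
  have prod: "\<psi> (\<Prod>i\<in>I. mpoly_var (iso_class (Xs (b i)))) = (\<Prod>i\<in>I. \<psi> (mpoly_var (iso_class (Xs (b i)))))"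
    for I :: "nat set" and b
  proof (induction I rule: infinite_finite_induct)
    case (insert i I)
    then show ?case
      using ring_hom_mult[OF \<psi>, of "mpoly_var (iso_class (Xs (b i)))" "\<Prod>i\<in>I. mpoly_var (iso_class (Xs (b i)))"] assms(3)
      by (simp add: mpoly_ring_simps ring_of_type_algebra_def mpoly_var_in_carrier
          prod_mpoly_var_in_carrier iso_class_in_iso_classes)
  qed (use ring_hom_one[OF \<psi>] in \<open>simp_all add: mpoly_ring_simps ring_of_type_algebra_def\<close>)
  obtain b where b: "bij_betw b {..<CARD('i)} (UNIV :: 'i set)"
    using ex_bij_betw_nat_finite[of "UNIV :: 'i set"] by (auto simp: atLeast0LessThan)
  have "K0_proj (mpoly_var (iso_class P)) = K0_proj (\<Prod>i<CARD('i). mpoly_var (iso_class (Xs (b i))))"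
    using assms(2,3) is_product_reindex[OF b assms(4)] by (intro K0_proj_prod)
  then have "\<phi> (mk_class P) = \<psi> (\<Prod>i<CARD('i). mpoly_var (iso_class (Xs (b i))))"
    unfolding class_eq[OF assms(2)] by (simp add: \<psi>_def)
  also have "\<dots> = (\<Prod>i<CARD('i). \<phi> (mk_class (Xs (b i))))"
    using assms(3) by (simp add: prod class_eq)
  also have "\<dots> = (\<Prod>i\<in>UNIV. \<phi> (mk_class (Xs i)))"
    by (rule prod.reindex_bij_betw[OF b])
  finally show ?thesis .
qed

section \<open>Multivariate power series\<close>

text \<open>Fubini for finite products. Read in the additive monoid of a ring, as
  \<open>add.finprod_Sigma\<close>, it merges the nested sums of an iterated convolution.\<close>

lemma (in comm_monoid) finprod_Sigma:
  assumes "finite A" "\<And>x. x \<in> A \<Longrightarrow> finite (B x)"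
    and "\<And>x y. x \<in> A \<Longrightarrow> y \<in> B x \<Longrightarrow> f x y \<in> carrier G"
  shows "(\<Otimes>x\<in>A. \<Otimes>y\<in>B x. f x y) = (\<Otimes>p\<in>Sigma A B. f (fst p) (snd p))"
  using assms
proof (induction A rule: finite_induct)
  case (insert a A)
  have "(\<Otimes>p\<in>Sigma (insert a A) B. f (fst p) (snd p))
      = (\<Otimes>p\<in>Pair a ` B a \<union> Sigma A B. f (fst p) (snd p))"
    by (rule arg_cong[where f = "finprod G _"]) auto
  also have "\<dots> = (\<Otimes>p\<in>Pair a ` B a. f (fst p) (snd p)) \<otimes> (\<Otimes>p\<in>Sigma A B. f (fst p) (snd p))"
    using insert by (intro finprod_Un_disjoint) auto
  also have "(\<Otimes>p\<in>Pair a ` B a. f (fst p) (snd p)) = (\<Otimes>y\<in>B a. f a y)"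
    using insert by (subst finprod_reindex) (auto intro: inj_onI)
  also have "(\<Otimes>p\<in>Sigma A B. f (fst p) (snd p)) = (\<Otimes>x\<in>A. \<Otimes>y\<in>B x. f x y)"
    using insert by simp
  also have "(\<Otimes>y\<in>B a. f a y) \<otimes> (\<Otimes>x\<in>A. \<Otimes>y\<in>B x. f x y) = (\<Otimes>x\<in>insert a A. \<Otimes>y\<in>B x. f x y)"
    using insert by (subst finprod_insert) auto
  finally show ?case ..
qed simp

abbreviation below :: "('n \<Rightarrow> nat) \<Rightarrow> ('n \<Rightarrow> nat) set" where
  "below d \<equiv> {e. \<forall>i. e i \<le> d i}"

lemma finite_below: "finite (below (d :: 'n::finite \<Rightarrow> nat))"
proof -
  have "below d = PiE UNIV (\<lambda>i. {..d i})"
    by (auto simp: PiE_def Pi_def)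
  then show ?thesis
    by (simp add: finite_PiE)
qed

text \<open>This reflection of the box \<open>below d\<close> exchanges the two factors of a
  convolution. Natural subtraction loses nothing here because no entry of \<open>e\<close> exceeds
  the corresponding entry of \<open>d\<close>.\<close>

lemma inj_on_diff_below: "inj_on (\<lambda>e i. d i - e i) (below (d :: 'n \<Rightarrow> nat))"
proof (rule inj_onI, rule ext)
  fix e e' :: "'n \<Rightarrow> nat" and i
  assume "e \<in> below d" "e' \<in> below d" "(\<lambda>i. d i - e i) = (\<lambda>i. d i - e' i)"
  then have "e i \<le> d i" "e' i \<le> d i" "d i - e i = d i - e' i"
    by (auto dest: fun_cong)
  then show "e i = e' i" by linarith
qed

lemma image_diff_below: "(\<lambda>e i. d i - e i) ` below (d :: 'n \<Rightarrow> nat) = below d"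
proof
  show "below d \<subseteq> (\<lambda>e i. d i - e i) ` below d"
  proof
    fix e assume "e \<in> below d"
    then have "e = (\<lambda>i. d i - (d i - e i))" by auto
    then show "e \<in> (\<lambda>e i. d i - e i) ` below d" by (rule image_eqI[where x = "\<lambda>i. d i - e i"]) auto
  qed
qed auto

section \<open>Multiplication of power series over a commutative ring\<close>

context
  fixes R :: "'a ring" (structure)
  assumes cring: "cring R"
begin

interpretation cring R by (rule cring)

lemma power_series_mult_closed:
  assumes "\<And>d. f d \<in> carrier R" "\<And>d. g d \<in> carrier R"
  shows "(f \<otimes>\<^bsub>power_series_ring R\<^esub> g) d \<in> carrier R"
  using assms by (auto simp: power_series_ring_def intro!: finsum_closed)

text \<open>Both sides sum over all a + b + c = d. Bracketing on the left lists the pairs (a + b,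
  a), the set \<open>?S\<close>; bracketing on the right lists the pairs (a, b), the set
  \<open>?T\<close>; \<open>?q\<close> translates between them.\<close>

lemma power_series_mult_assoc:
  fixes f g h :: "('n::finite \<Rightarrow> nat) \<Rightarrow> 'a"
  assumes f: "\<And>d. f d \<in> carrier R" and g: "\<And>d. g d \<in> carrier R" and h: "\<And>d. h d \<in> carrier R"
  shows "(f \<otimes>\<^bsub>power_series_ring R\<^esub> g) \<otimes>\<^bsub>power_series_ring R\<^esub> h
    = f \<otimes>\<^bsub>power_series_ring R\<^esub> (g \<otimes>\<^bsub>power_series_ring R\<^esub> h)"
proof
  fix d :: "'n \<Rightarrow> nat"
  let ?S = "Sigma (below d) below" and ?T = "Sigma (below d) (\<lambda>a. below (\<lambda>i. d i - a i))"
  let ?q = "\<lambda>p :: ('n \<Rightarrow> nat) \<times> ('n \<Rightarrow> nat). (\<lambda>i. fst p i + snd p i, fst p)"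
  have q: "?S = ?q ` ?T"
  proof
    show "?S \<subseteq> ?q ` ?T"
    proof
      fix p assume p: "p \<in> ?S"
      then have "p = ?q (snd p, \<lambda>i. fst p i - snd p i)"
        by (auto simp: prod_eq_iff)
      moreover have "(snd p, \<lambda>i. fst p i - snd p i) \<in> ?T"
        using p by (auto intro: diff_le_mono) (meson order_trans)
      ultimately show "p \<in> ?q ` ?T" by blast
    qed
    show "?q ` ?T \<subseteq> ?S"
      by (auto simp: le_diff_conv2 add.commute)
  qed
  have inj: "inj_on ?q ?T"
    by (auto simp: inj_on_def fun_eq_iff)
  have "((f \<otimes>\<^bsub>power_series_ring R\<^esub> g) \<otimes>\<^bsub>power_series_ring R\<^esub> h) d
      = (\<Oplus>e\<in>below d. \<Oplus>a\<in>below e. f a \<otimes> g (\<lambda>i. e i - a i) \<otimes> h (\<lambda>i. d i - e i))"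
    using f g h
    by (auto simp: power_series_ring_def finite_below intro!: finsum_cong' finsum_ldistr finsum_closed)
  also have "\<dots> = (\<Oplus>p\<in>?S. f (snd p) \<otimes> g (\<lambda>i. fst p i - snd p i) \<otimes> h (\<lambda>i. d i - fst p i))"
    using f g h by (intro add.finprod_Sigma) (auto simp: finite_below)
  also have "\<dots> = (\<Oplus>p\<in>?T. f (fst p) \<otimes> (g (snd p) \<otimes> h (\<lambda>i. d i - fst p i - snd p i)))"
    unfolding q using f g h by (subst add.finprod_reindex[OF _ inj]) (auto simp: m_assoc)
  also have "\<dots> = (\<Oplus>a\<in>below d. \<Oplus>b\<in>below (\<lambda>i. d i - a i). f a \<otimes> (g b \<otimes> h (\<lambda>i. d i - a i - b i)))"
    using f g h by (intro add.finprod_Sigma[symmetric]) (auto simp: finite_below)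
  also have "\<dots> = (f \<otimes>\<^bsub>power_series_ring R\<^esub> (g \<otimes>\<^bsub>power_series_ring R\<^esub> h)) d"
    using f g h
    by (auto simp: power_series_ring_def finite_below intro!: finsum_cong' finsum_rdistr[symmetric] finsum_closed)
  finally show "((f \<otimes>\<^bsub>power_series_ring R\<^esub> g) \<otimes>\<^bsub>power_series_ring R\<^esub> h) d
      = (f \<otimes>\<^bsub>power_series_ring R\<^esub> (g \<otimes>\<^bsub>power_series_ring R\<^esub> h)) d" .
qed

lemma power_series_mult_commute:
  fixes f g :: "('n::finite \<Rightarrow> nat) \<Rightarrow> 'a"
  assumes f: "\<And>d. f d \<in> carrier R" and g: "\<And>d. g d \<in> carrier R"
  shows "f \<otimes>\<^bsub>power_series_ring R\<^esub> g = g \<otimes>\<^bsub>power_series_ring R\<^esub> f"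
proof
  fix d :: "'n \<Rightarrow> nat"
  have "(\<Oplus>e\<in>below d. f e \<otimes> g (\<lambda>i. d i - e i))
      = (\<Oplus>e\<in>(\<lambda>e i. d i - e i) ` below d. f e \<otimes> g (\<lambda>i. d i - e i))"
    by (simp add: image_diff_below)
  also have "\<dots> = (\<Oplus>e\<in>below d. f (\<lambda>i. d i - e i) \<otimes> g (\<lambda>i. d i - (d i - e i)))"
    using f g by (subst add.finprod_reindex[OF _ inj_on_diff_below]) auto
  also have "\<dots> = (\<Oplus>e\<in>below d. g e \<otimes> f (\<lambda>i. d i - e i))"
    using f g by (auto simp: m_comm intro!: finsum_cong')
  finally show "(f \<otimes>\<^bsub>power_series_ring R\<^esub> g) d = (g \<otimes>\<^bsub>power_series_ring R\<^esub> f) d"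
    by (simp add: power_series_ring_def)
qed

text \<open>The product of the zeta functions over the variables is a \<open>finprod\<close>, which
  is governed by this monoid structure.\<close>

lemma comm_monoid_power_series_ring:
  "comm_monoid (power_series_ring R :: (('n::finite \<Rightarrow> nat) \<Rightarrow> 'a) ring)"
proof -
  let ?P = "power_series_ring R :: (('n \<Rightarrow> nat) \<Rightarrow> 'a) ring"
  have car: "f \<in> carrier ?P \<longleftrightarrow> (\<forall>d. f d \<in> carrier R)" for f
    by (simp add: power_series_ring_def)
  show ?thesis
  proof (rule comm_monoidI; (unfold car)?)
    show "\<forall>d. \<one>\<^bsub>?P\<^esub> d \<in> carrier R"
      by (simp add: power_series_ring_def)
  next
    fix f :: "('n \<Rightarrow> nat) \<Rightarrow> 'a"
    assume f: "\<forall>d. f d \<in> carrier R"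
    show "\<one>\<^bsub>?P\<^esub> \<otimes>\<^bsub>?P\<^esub> f = f"
    proof
      fix d :: "'n \<Rightarrow> nat"
      have "(\<one>\<^bsub>?P\<^esub> \<otimes>\<^bsub>?P\<^esub> f) d = (\<Oplus>e\<in>below d. if (\<lambda>_. 0) = e then f (\<lambda>i. d i - e i) else \<zero>)"
        using f unfolding power_series_ring_def by (auto simp: fun_eq_iff intro!: finsum_cong')
      also have "\<dots> = f d"
        using f by (subst add.finprod_singleton) (auto simp: finite_below)
      finally show "(\<one>\<^bsub>?P\<^esub> \<otimes>\<^bsub>?P\<^esub> f) d = f d" .
    qed
  next
    fix f g :: "('n \<Rightarrow> nat) \<Rightarrow> 'a"
    assume "\<forall>d. f d \<in> carrier R" "\<forall>d. g d \<in> carrier R"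
    then show "f \<otimes>\<^bsub>?P\<^esub> g = g \<otimes>\<^bsub>?P\<^esub> f"
      by (intro power_series_mult_commute) auto
  qed (simp_all add: power_series_mult_closed power_series_mult_assoc)
qed

end

section \<open>Coefficients of products under a ring homomorphism\<close>

context
  fixes R :: "'a ring" and \<phi> :: "'a \<Rightarrow> 'r::comm_ring_1"
  assumes cring: "cring R" and hom: "\<phi> \<in> ring_hom R ring_of_type_algebra"
begin

interpretation R: cring R by (rule cring)

lemma hom_simps:
  "\<lbrakk>x \<in> carrier R; y \<in> carrier R\<rbrakk> \<Longrightarrow> \<phi> (x \<otimes>\<^bsub>R\<^esub> y) = \<phi> x * \<phi> y"
  "\<lbrakk>x \<in> carrier R; y \<in> carrier R\<rbrakk> \<Longrightarrow> \<phi> (x \<oplus>\<^bsub>R\<^esub> y) = \<phi> x + \<phi> y"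
  "\<phi> \<one>\<^bsub>R\<^esub> = 1"
  using ring_hom_memE[OF hom] by (simp_all add: ring_of_type_algebra_def)

lemma hom_zero: "\<phi> \<zero>\<^bsub>R\<^esub> = 0"
  using hom_simps(2)[of "\<zero>\<^bsub>R\<^esub>" "\<zero>\<^bsub>R\<^esub>"] by simp

lemma hom_uminus: "x \<in> carrier R \<Longrightarrow> \<phi> (\<ominus>\<^bsub>R\<^esub> x) = - \<phi> x"
  using hom_simps(2)[of "\<ominus>\<^bsub>R\<^esub> x" x] by (simp add: R.l_neg hom_zero eq_neg_iff_add_eq_0)

lemma hom_pow: "x \<in> carrier R \<Longrightarrow> \<phi> (x [^]\<^bsub>R\<^esub> (n::nat)) = \<phi> x ^ n"
  by (induction n) (simp_all add: hom_simps mult.commute)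

lemma hom_finsum:
  assumes "\<And>i. i \<in> I \<Longrightarrow> f i \<in> carrier R"
  shows "\<phi> (\<Oplus>\<^bsub>R\<^esub>i\<in>I. f i) = (\<Sum>i\<in>I. \<phi> (f i))"
  using assms
proof (induction I rule: infinite_finite_induct)
  case (insert i I)
  have "f \<in> I \<rightarrow> carrier R" "f i \<in> carrier R" using insert by auto
  then show ?case
    using insert by (simp add: hom_simps R.finsum_insert R.finsum_closed)
qed (simp_all add: hom_zero R.finsum_infinite)

lemma hom_power_series_mult:
  fixes f g :: "('n::finite \<Rightarrow> nat) \<Rightarrow> 'a"
  assumes "\<And>d. f d \<in> carrier R" "\<And>d. g d \<in> carrier R"
  shows "\<phi> ((f \<otimes>\<^bsub>power_series_ring R\<^esub> g) d) = (\<Sum>e\<in>below d. \<phi> (f e) * \<phi> (g (\<lambda>i. d i - e i)))"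
proof -
  have "\<phi> ((f \<otimes>\<^bsub>power_series_ring R\<^esub> g) d) = \<phi> (\<Oplus>\<^bsub>R\<^esub>e\<in>below d. f e \<otimes>\<^bsub>R\<^esub> g (\<lambda>i. d i - e i))"
    by (simp add: power_series_ring_def)
  also have "\<dots> = (\<Sum>e\<in>below d. \<phi> (f e) * \<phi> (g (\<lambda>i. d i - e i)))"
    using assms by (subst hom_finsum) (auto simp: hom_simps)
  finally show ?thesis .
qed

text \<open>Each factor has a variable of its own, so a monomial arises in at most one way. The
  subset \<open>I\<close> of the variables is there for the induction; a positive exponent outside
  \<open>I\<close> makes the coefficient vanish.\<close>

lemma hom_prod_series_in:
  fixes d :: "'n::finite \<Rightarrow> nat"
  assumes z: "\<And>j. z j \<in> carrier R"
  shows "\<phi> ((\<Otimes>\<^bsub>power_series_ring R\<^esub>i\<in>I. series_in R i z) d)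
    = (if \<forall>i. i \<notin> I \<longrightarrow> d i = 0 then \<Prod>i\<in>I. \<phi> (z (d i)) else 0)"
proof -
  let ?P = "power_series_ring R :: (('n \<Rightarrow> nat) \<Rightarrow> 'a) ring"
  interpret P: comm_monoid ?P
    by (rule comm_monoid_power_series_ring[OF cring])
  have car: "f \<in> carrier ?P \<longleftrightarrow> (\<forall>d. f d \<in> carrier R)" for f
    by (simp add: power_series_ring_def)
  have series_car: "series_in R i z \<in> carrier ?P" for i
    using z by (simp add: car series_in_def)
  have "finite I" by simp
  then show ?thesis
  proof (induction I arbitrary: d rule: finite_induct)
    case empty
    have "\<one>\<^bsub>?P\<^esub> d = (if \<forall>i. d i = 0 then \<one>\<^bsub>R\<^esub> else \<zero>\<^bsub>R\<^esub>)"
      by (simp add: power_series_ring_def)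
    then show ?case
      by (simp add: hom_simps hom_zero)
  next
    case (insert i I)
    let ?Q = "\<Otimes>\<^bsub>?P\<^esub>i\<in>I. series_in R i z"
    have Q: "?Q \<in> carrier ?P"
      using series_car by (intro P.finprod_closed) auto
    \<comment> \<open>The only surviving term of the convolution: the factor in variable
      \<open>i\<close> forces \<open>e\<close> to vanish off \<open>i\<close>, and the product over
      \<open>I\<close> does not involve variable \<open>i\<close>, which forces
      \<open>e i = d i\<close>.\<close>
    define e0 where "e0 = (\<lambda>j. if j = i then d i else 0)"
    have "\<phi> ((\<Otimes>\<^bsub>?P\<^esub>i\<in>insert i I. series_in R i z) d) = \<phi> ((series_in R i z \<otimes>\<^bsub>?P\<^esub> ?Q) d)"
      using insert series_car by (subst P.finprod_insert) auto
    also have "\<dots> = (\<Sum>e\<in>below d. \<phi> (series_in R i z e) * \<phi> (?Q (\<lambda>j. d j - e j)))"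
      using series_car Q by (intro hom_power_series_mult) (auto simp: car)
    also have "\<dots> = (\<Sum>e\<in>{e0}. \<phi> (series_in R i z e) * \<phi> (?Q (\<lambda>j. d j - e j)))"
    proof (intro sum.mono_neutral_right ballI)
      fix e assume e: "e \<in> below d - {e0}"
      show "\<phi> (series_in R i z e) * \<phi> (?Q (\<lambda>j. d j - e j)) = 0"
      proof (cases "\<forall>j. j \<noteq> i \<longrightarrow> e j = 0")
        case True
        then have "e = e0" if "e i = d i" using that by (auto simp: e0_def fun_eq_iff)
        with e have "e i \<noteq> d i" by blast
        moreover have "e i \<le> d i" using e by simp
        ultimately have "\<phi> (?Q (\<lambda>j. d j - e j)) = 0"
          using insert by auto
        then show ?thesis by simp
      qed (auto simp: series_in_def hom_zero)
    qed (auto simp: finite_below e0_def)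
    also have "\<dots> = \<phi> (z (d i)) * \<phi> (?Q (\<lambda>j. d j - e0 j))"
      by (simp add: series_in_def e0_def)
    also have "\<dots> = (if \<forall>j. j \<notin> insert i I \<longrightarrow> d j = 0 then \<Prod>j\<in>insert i I. \<phi> (z (d j)) else 0)"
    proof -
      have iff: "(\<forall>j. j \<notin> I \<longrightarrow> d j - e0 j = 0) \<longleftrightarrow> (\<forall>j. j \<notin> insert i I \<longrightarrow> d j = 0)"
        by (auto simp: e0_def)
      moreover have "(\<Prod>j\<in>I. \<phi> (z (d j - e0 j))) = (\<Prod>j\<in>I. \<phi> (z (d j)))"
        using insert by (intro prod.cong) (auto simp: e0_def)
      ultimately show ?thesis
        unfolding insert.IH iff using insert(1,2) by auto
    qed
    finally show ?case .
  qed
qed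

end

section \<open>Complete normed rings\<close>

locale complete_normed_ring =
  fixes nrm :: "'r::comm_ring_1 \<Rightarrow> real"
  assumes complete_ring_norm: "complete_ring_norm nrm"
begin

lemma nrm_nonneg [simp]: "nrm x \<ge> 0"
  and nrm_eq_0_iff [simp]: "nrm x = 0 \<longleftrightarrow> x = 0"
  and nrm_minus [simp]: "nrm (- x) = nrm x"
  and nrm_triangle: "nrm (x + y) \<le> nrm x + nrm y"
  and nrm_mult: "nrm (x * y) \<le> nrm x * nrm y"
  using complete_ring_norm by (auto simp: complete_ring_norm_def)

lemma nrm_0 [simp]: "nrm 0 = 0"
  by simp

lemma nrm_minus_commute: "nrm (x - y) = nrm (y - x)"
  by (metis minus_diff_eq nrm_minus)

lemma nrm_one_pos: "nrm 1 > 0"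
  using nrm_nonneg[of 1] nrm_eq_0_iff[of 1] by (simp add: less_le del: nrm_nonneg)

lemma nrm_sum: "nrm (sum f I) \<le> (\<Sum>i\<in>I. nrm (f i))"
  by (induction I rule: infinite_finite_induct) (auto intro: order_trans[OF nrm_triangle])

text \<open>The factor \<open>nrm 1\<close> pays for the empty product, since sub-multiplicativity
  only gives \<open>nrm 1 \<ge> 1\<close>.\<close>

lemma nrm_prod: "nrm (prod f I) \<le> nrm 1 * (\<Prod>i\<in>I. nrm (f i))"
proof (induction I rule: infinite_finite_induct)
  case (insert i I)
  have "nrm (f i * prod f I) \<le> nrm (f i) * (nrm 1 * (\<Prod>i\<in>I. nrm (f i)))"
    using insert.IH by (intro order_trans[OF nrm_mult] mult_left_mono) auto
  then show ?case
    using insert.hyps by (simp add: mult_ac)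
qed auto

lemma nrm_power: "nrm (x ^ n) \<le> nrm 1 * nrm x ^ n"
  using nrm_prod[of "\<lambda>_. x" "{..<n}"] by simp

text \<open>The norm is an argument and not a class instance, so the ring has no topology of its own
  and convergence is phrased as a real limit. The filter is arbitrary because sequences, finite
  index sets and vectors of degrees all occur.\<close>

definition tends :: "('b \<Rightarrow> 'r) \<Rightarrow> 'r \<Rightarrow> 'b filter \<Rightarrow> bool" where
  "tends f l F \<longleftrightarrow> ((\<lambda>x. nrm (f x - l)) \<longlongrightarrow> 0) F"

lemma tends_iff: "tends f l F \<longleftrightarrow> (\<forall>\<epsilon>>0. \<forall>\<^sub>F x in F. nrm (f x - l) < \<epsilon>)"
  by (simp add: tends_def tendsto_iff)

lemma tends_const: "tends (\<lambda>_. c) c F"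
  by (simp add: tends_def)

lemma tends_compose: "tends f l G \<Longrightarrow> filterlim g G F \<Longrightarrow> tends (\<lambda>x. f (g x)) l F"
  unfolding tends_def by (rule filterlim_compose)

lemma tends_mult:
  assumes "tends f a F" "tends g b F"
  shows "tends (\<lambda>x. f x * g x) (a * b) F"
  unfolding tends_def
proof (rule tendsto_sandwich[OF always_eventually always_eventually tendsto_const])
  let ?h = "\<lambda>x. nrm (f x - a) * nrm (g x - b) + nrm (f x - a) * nrm b + nrm a * nrm (g x - b)"
  show "\<forall>x. nrm (f x * g x - a * b) \<le> ?h x"
  proof
    fix x
    have "f x * g x - a * b = (f x - a) * (g x - b) + (f x - a) * b + a * (g x - b)"
      by (simp add: algebra_simps)
    also have "nrm \<dots> \<le> ?h x"
      by (intro order_trans[OF nrm_triangle] add_mono nrm_mult)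
    finally show "nrm (f x * g x - a * b) \<le> ?h x" .
  qed
  have "(?h \<longlongrightarrow> 0 * 0 + 0 * nrm b + nrm a * 0) F"
    using assms unfolding tends_def by (intro tendsto_intros)
  then show "(?h \<longlongrightarrow> 0) F" by simp
qed simp

lemma tends_prod:
  assumes "\<And>i. i \<in> I \<Longrightarrow> tends (f i) (a i) F"
  shows "tends (\<lambda>x. \<Prod>i\<in>I. f i x) (\<Prod>i\<in>I. a i) F"
  using assms
  by (induction I rule: infinite_finite_induct) (auto intro: tends_mult tends_const)

lemma tends_unique:
  assumes "tends f a F" "tends f b F" "F \<noteq> bot"
  shows "a = b"
proof -
  have "((\<lambda>x. nrm (f x - a) + nrm (f x - b)) \<longlongrightarrow> 0 + 0) F"
    using assms(1,2) unfolding tends_def by (intro tendsto_intros)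
  moreover have "nrm (a - b) \<le> nrm (f x - a) + nrm (f x - b)" for x
    using nrm_triangle[of "a - f x" "f x - b"] by (simp add: nrm_minus_commute)
  ultimately have "nrm (a - b) \<le> 0"
    using tendsto_lowerbound[OF _ always_eventually assms(3)] by fastforce
  then have "nrm (a - b) = 0"
    by (intro antisym) auto
  then show ?thesis by simp
qed

lemma tends_bounded:
  fixes f :: "nat \<Rightarrow> 'r"
  assumes "tends f l sequentially"
  obtains C where "\<And>n. nrm (f n) \<le> C"
proof -
  obtain K where K: "norm (nrm (f n - l)) \<le> K" for n
    using convergent_imp_Bseq[OF convergentI[OF assms[unfolded tends_def]]] by (auto simp: Bseq_def)
  have "nrm (f n) \<le> K + nrm l" for n
    using nrm_triangle[of "f n - l" l] K[of n] by simp
  then show ?thesis by (rule that)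
qed

lemma cauchy_tends:
  fixes s :: "nat \<Rightarrow> 'r"
  assumes "\<And>\<epsilon>. \<epsilon> > 0 \<Longrightarrow> \<exists>N. \<forall>m\<ge>N. \<forall>n\<ge>N. nrm (s m - s n) < \<epsilon>"
  obtains l where "tends s l sequentially"
proof -
  interpret M: Metric_space UNIV "\<lambda>x y. nrm (x - y)"
  proof
    show "nrm (x - z) \<le> nrm (x - y) + nrm (y - z)" for x y z
      using nrm_triangle[of "x - y" "y - z"] by simp
  qed (auto simp: nrm_minus_commute)
  have "M.MCauchy s"
    using assms by (auto simp: M.MCauchy_def)
  moreover have "M.mcomplete"
    using complete_ring_norm by (simp add: complete_ring_norm_def)
  ultimately obtain l where "limitin M.mtopology s l sequentially"
    by (auto simp: M.mcomplete_def)
  then have "tends s l sequentially"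
    by (auto simp: M.limitin_metric tends_iff)
  then show ?thesis by (rule that)
qed

text \<open>The sums over \<open>D\<close> and over \<open>E \<union> D\<close> both lie within half
  of \<epsilon> of the total, and their difference is the sum over \<open>E\<close>.\<close>

lemma summable_tail:
  assumes "(\<lambda>i. nrm (f i)) summable_on UNIV" "\<epsilon> > 0"
  obtains D where "finite D" "\<And>E. finite E \<Longrightarrow> E \<inter> D = {} \<Longrightarrow> (\<Sum>i\<in>E. nrm (f i)) < \<epsilon>"
proof -
  obtain S where "((\<lambda>i. nrm (f i)) has_sum S) UNIV"
    using assms(1) by (auto simp: summable_on_def)
  then have "((\<lambda>D. \<Sum>i\<in>D. nrm (f i)) \<longlongrightarrow> S) (finite_subsets_at_top UNIV)"
    by (simp add: has_sum_def)
  then have "\<forall>\<^sub>F D in finite_subsets_at_top UNIV. dist (\<Sum>i\<in>D. nrm (f i)) S < \<epsilon> / 2"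
    using assms(2) unfolding tendsto_iff by (meson half_gt_zero)
  then obtain D where D: "finite D"
    "\<And>E. finite E \<Longrightarrow> D \<subseteq> E \<Longrightarrow> dist (\<Sum>i\<in>E. nrm (f i)) S < \<epsilon> / 2"
    by (auto simp: eventually_finite_subsets_at_top)
  show ?thesis
  proof
    fix E assume E: "finite E" "E \<inter> D = {}"
    have "(\<Sum>i\<in>E \<union> D. nrm (f i)) = (\<Sum>i\<in>E. nrm (f i)) + (\<Sum>i\<in>D. nrm (f i))"
      using E D(1) by (intro sum.union_disjoint) auto
    moreover have "\<bar>(\<Sum>i\<in>D. nrm (f i)) - S\<bar> < \<epsilon> / 2" "\<bar>(\<Sum>i\<in>E \<union> D. nrm (f i)) - S\<bar> < \<epsilon> / 2"
      using D(2)[of D] D(2)[of "E \<union> D"] D(1) E(1) by (simp_all add: dist_real_def)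
    ultimately show "(\<Sum>i\<in>E. nrm (f i)) < \<epsilon>"
      by linarith
  qed (rule D(1))
qed

text \<open>Completeness speaks about sequences, so the limit is found along the initial segments. A
  finite set \<open>D\<close> beyond which all sums are small then compares an arbitrary finite set
  with a long segment.\<close>

lemma summable_tends:
  fixes f :: "nat \<Rightarrow> 'r"
  assumes "(\<lambda>i. nrm (f i)) summable_on UNIV"
  obtains s where "tends (sum f) s (finite_subsets_at_top UNIV)"
proof -
  have cauchy: "\<exists>D. finite D \<and> (\<forall>E. finite E \<longrightarrow> D \<subseteq> E \<longrightarrow> nrm (sum f E - sum f D) < \<epsilon>)"
    if "\<epsilon> > 0" for \<epsilon>
  proof -
    obtain D where D: "finite D" "\<And>E. finite E \<Longrightarrow> E \<inter> D = {} \<Longrightarrow> (\<Sum>i\<in>E. nrm (f i)) < \<epsilon>"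
      using summable_tail[OF assms \<open>\<epsilon> > 0\<close>] by blast
    have "nrm (sum f E - sum f D) < \<epsilon>" if "finite E" "D \<subseteq> E" for E
    proof -
      have "sum f E - sum f D = sum f (E - D)"
        using that by (simp add: sum_diff)
      also have "nrm \<dots> \<le> (\<Sum>i\<in>E - D. nrm (f i))" by (rule nrm_sum)
      also have "\<dots> < \<epsilon>" using that by (intro D(2)) auto
      finally show ?thesis .
    qed
    with D(1) show ?thesis by blast
  qed
  have initial: "\<exists>N. \<forall>n\<ge>N. D \<subseteq> {..<n}" if "finite D" for D :: "nat set"
    using that by (metis finite_nat_iff_bounded lessThan_subset_iff order_trans)
  have "\<exists>N. \<forall>m\<ge>N. \<forall>n\<ge>N. nrm (sum f {..<m} - sum f {..<n}) < \<epsilon>" if "\<epsilon> > 0" for \<epsilon>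
  proof -
    obtain D where D: "finite D"
      "\<And>E. finite E \<Longrightarrow> D \<subseteq> E \<Longrightarrow> nrm (sum f E - sum f D) < \<epsilon> / 2"
      using cauchy[of "\<epsilon> / 2"] \<open>\<epsilon> > 0\<close> by (meson half_gt_zero)
    obtain N where N: "\<And>n. n \<ge> N \<Longrightarrow> D \<subseteq> {..<n}"
      using initial[OF D(1)] by blast
    have "nrm (sum f {..<m} - sum f {..<n}) < \<epsilon>" if "m \<ge> N" "n \<ge> N" for m n
      using nrm_triangle[of "sum f {..<m} - sum f D" "sum f D - sum f {..<n}"]
        D(2)[of "{..<m}"] D(2)[of "{..<n}"] N that
      by (simp add: nrm_minus_commute[of "sum f D"])
    then show ?thesis by blast
  qed
  then obtain s where s: "tends (\<lambda>n. sum f {..<n}) s sequentially"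
    by (rule cauchy_tends)
  have "tends (sum f) s (finite_subsets_at_top UNIV)"
    unfolding tends_iff
  proof (intro allI impI)
    fix \<epsilon> :: real assume "\<epsilon> > 0"
    obtain D where D: "finite D"
      "\<And>E. finite E \<Longrightarrow> D \<subseteq> E \<Longrightarrow> nrm (sum f E - sum f D) < \<epsilon> / 3"
      using cauchy[of "\<epsilon> / 3"] \<open>\<epsilon> > 0\<close> by (meson divide_pos_pos zero_less_numeral)
    obtain N where N: "\<And>n. n \<ge> N \<Longrightarrow> D \<subseteq> {..<n}"
      using initial[OF D(1)] by blast
    have "\<forall>\<^sub>F n in sequentially. nrm (sum f {..<n} - s) < \<epsilon> / 3"
      using s \<open>\<epsilon> > 0\<close> unfolding tends_iff by (meson divide_pos_pos zero_less_numeral)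
    then obtain n where n: "n \<ge> N" "nrm (sum f {..<n} - s) < \<epsilon> / 3"
      unfolding eventually_sequentially by (meson max.cobounded1 max.cobounded2)
    have "nrm (sum f E - s) < \<epsilon>" if "finite E" "D \<subseteq> E" for E
      using nrm_triangle[of "sum f E - sum f D" "sum f D - sum f {..<n}"]
        nrm_triangle[of "sum f E - sum f {..<n}" "sum f {..<n} - s"]
        D(2)[OF that] D(2)[OF finite_lessThan N[OF n(1)]] n(2)
      by (simp add: nrm_minus_commute[of "sum f D"])
    then show "\<forall>\<^sub>F E in finite_subsets_at_top UNIV. nrm (sum f E - s) < \<epsilon>"
      using D(1) by (auto simp: eventually_finite_subsets_at_top)
  qed
  then show ?thesis by (rule that)
qed

text \<open>Outside a finite set \<open>D\<close>, summability of \<open>f\<close> beats the uniform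
  bound on the weights; on \<open>D\<close> the weights are already close to \<open>l\<close>. The
  sets \<open>I x\<close> only have to exhaust the index type, which covers initial segments as well
  as boxes.\<close>

lemma tends_weighted_sum:
  assumes summable: "(\<lambda>i. nrm (f i)) summable_on UNIV"
    and f: "tends (sum f) s (finite_subsets_at_top UNIV)"
    and I: "filterlim I (finite_subsets_at_top UNIV) F"
    and w: "\<And>i. tends (\<lambda>x. w x i) l F"
    and bounded: "\<And>x i. nrm (w x i) \<le> C"
  shows "tends (\<lambda>x. \<Sum>i\<in>I x. f i * w x i) (s * l) F"
  unfolding tends_iff
proof (intro allI impI)
  fix \<epsilon> :: real assume \<epsilon>: "\<epsilon> > 0"
  \<comment> \<open>A bound for \<open>nrm (w x i - l)\<close>; the summand 1 keeps it positive, so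
    that \<epsilon> can be divided by it.\<close>
  define K where "K = C + nrm l + 1"
  have "C \<ge> 0" using bounded nrm_nonneg order_trans by blast
  then have K: "K > 0" "C + nrm l \<le> K" by (auto simp: K_def add_nonneg_pos)
  obtain D where D: "finite D" "\<And>E. finite E \<Longrightarrow> E \<inter> D = {} \<Longrightarrow> (\<Sum>i\<in>E. nrm (f i)) < \<epsilon> / (3 * K)"
    using summable_tail[OF summable, of "\<epsilon> / (3 * K)"] \<epsilon> K(1) by auto
  have "((\<lambda>x. \<Sum>i\<in>D. nrm (f i) * nrm (w x i - l)) \<longlongrightarrow> (\<Sum>i\<in>D. nrm (f i) * 0)) F"
    using w unfolding tends_def by (intro tendsto_intros)
  then have ev1: "\<forall>\<^sub>F x in F. (\<Sum>i\<in>D. nrm (f i) * nrm (w x i - l)) < \<epsilon> / 3"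
    using \<epsilon> by (intro order_tendstoD(2)) auto
  have "tends (\<lambda>x. sum f (I x) * l) (s * l) F"
    by (intro tends_mult tends_const tends_compose[OF f I])
  then have ev2: "\<forall>\<^sub>F x in F. nrm (sum f (I x) * l - s * l) < \<epsilon> / 3"
    using \<epsilon> unfolding tends_iff by (meson divide_pos_pos zero_less_numeral)
  have "\<forall>\<^sub>F E in finite_subsets_at_top UNIV. finite E \<and> D \<subseteq> E"
    using D(1) by (auto simp: eventually_finite_subsets_at_top)
  then have ev3: "\<forall>\<^sub>F x in F. finite (I x) \<and> D \<subseteq> I x"
    using I by (auto simp: filterlim_iff)
  show "\<forall>\<^sub>F x in F. nrm ((\<Sum>i\<in>I x. f i * w x i) - s * l) < \<epsilon>"
    using ev1 ev2 ev3
  proof eventually_elim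
    case (elim x)
    have split: "(\<Sum>i\<in>I x. f i * w x i) - s * l
        = (\<Sum>i\<in>D. f i * (w x i - l)) + (\<Sum>i\<in>I x - D. f i * (w x i - l)) + (sum f (I x) * l - s * l)"
    proof -
      have "(\<Sum>i\<in>D. f i * (w x i - l)) + (\<Sum>i\<in>I x - D. f i * (w x i - l)) = (\<Sum>i\<in>I x. f i * (w x i - l))"
        using elim(3) by (simp add: sum.subset_diff[of D "I x"] add.commute)
      then show ?thesis
        by (simp add: right_diff_distrib sum_subtractf sum_distrib_right)
    qed
    have "nrm (\<Sum>i\<in>D. f i * (w x i - l)) < \<epsilon> / 3"
      using elim(1) by (intro le_less_trans[OF order_trans[OF nrm_sum sum_mono[OF nrm_mult]]])
    moreover have "nrm (\<Sum>i\<in>I x - D. f i * (w x i - l)) \<le> \<epsilon> / 3"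
    proof -
      have "nrm (w x i - l) \<le> K" for i
        using nrm_triangle[of "w x i" "- l"] bounded[of x i] K(2) by simp
      then have "nrm (\<Sum>i\<in>I x - D. f i * (w x i - l)) \<le> (\<Sum>i\<in>I x - D. nrm (f i) * K)"
        by (intro order_trans[OF nrm_sum] sum_mono order_trans[OF nrm_mult] mult_left_mono) auto
      also have "\<dots> = (\<Sum>i\<in>I x - D. nrm (f i)) * K"
        by (simp add: sum_distrib_right)
      also have "\<dots> \<le> \<epsilon> / (3 * K) * K"
        using D(2)[of "I x - D"] elim(3) K(1) by (intro mult_right_mono less_imp_le) auto
      finally show ?thesis using K(1) by simp
    qed
    ultimately show ?case
      unfolding split
      using elim(2) nrm_triangle[of "\<Sum>i\<in>D. f i * (w x i - l)" "\<Sum>i\<in>I x - D. f i * (w x i - l)"]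
        nrm_triangle[of "(\<Sum>i\<in>D. f i * (w x i - l)) + (\<Sum>i\<in>I x - D. f i * (w x i - l))" "sum f (I x) * l - s * l"]
      by linarith
  qed
qed

text \<open>The inverse is the sum of the powers of \<open>y\<close>. Its norm bound is what keeps
  inverses under control near 1.\<close>

lemma geometric_inverse:
  assumes "nrm y < 1"
  obtains s where "(1 - y) * s = 1" "nrm s \<le> nrm 1 / (1 - nrm y)"
proof -
  have "summable (\<lambda>n. nrm 1 * nrm y ^ n)"
    using assms by (intro summable_mult summable_geometric) simp
  then have "summable (\<lambda>n. nrm (y ^ n))"
    by (rule summable_comparison_test') (use nrm_power in auto)
  then have "(\<lambda>n. nrm (y ^ n)) summable_on UNIV"
    by (subst summable_on_UNIV_nonneg_real_iff) auto
  then obtain s where s: "tends (sum (\<lambda>n. y ^ n)) s (finite_subsets_at_top UNIV)"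
    by (rule summable_tends)
  have "tends (\<lambda>n. (1 - y) * (\<Sum>i<n. y ^ i)) ((1 - y) * s) sequentially"
    by (intro tends_mult tends_const tends_compose[OF s filterlim_lessThan_at_top])
  then have lim: "tends (\<lambda>n. 1 - y ^ n) ((1 - y) * s) sequentially"
    by (simp add: one_diff_power_eq)
  have "tends (\<lambda>n. 1 - y ^ n) 1 sequentially"
    using \<open>summable (\<lambda>n. nrm (y ^ n))\<close> by (simp add: tends_def summable_LIMSEQ_zero)
  with lim have s1: "(1 - y) * s = 1"
    by (rule tends_unique) simp
  \<comment> \<open>From s = 1 + y s.\<close>
  have "nrm s \<le> nrm 1 + nrm y * nrm s"
    using nrm_triangle[of 1 "y * s"] nrm_mult[of y s] s1 by (simp add: algebra_simps)
  then have "nrm s \<le> nrm 1 / (1 - nrm y)"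
    using assms by (simp add: pos_le_divide_eq algebra_simps)
  with s1 show ?thesis by (rule that)
qed

text \<open>Only the limit \<open>b\<close> is known to be a unit. As \<open>den x * c\<close> tends
  to 1, it is eventually 1 - y with \<open>y\<close> small; if \<open>t\<close> inverts 1 - y, then
  \<open>c * t\<close> inverts \<open>den x\<close>.\<close>

lemma tends_quotient:
  assumes "tends num (s * b) F" "tends den b F" "b * c = 1" "\<epsilon> > 0"
  shows "\<forall>\<^sub>F x in F. \<exists>r. den x * r = 1 \<and> nrm (num x * r - s) < \<epsilon>"
proof -
  \<comment> \<open>Chosen so that the final estimate comes out as \<epsilon>: the inverse
    \<open>t\<close> contributes at most \<open>2 * nrm 1\<close>, and the two errors contribute
    \<delta> and \<open>nrm s * \<delta>\<close>.\<close>
  define \<delta> where "\<delta> = \<epsilon> / (2 * nrm 1 * (1 + nrm s))"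
  have \<delta>: "\<delta> > 0"
    using assms(4) nrm_one_pos by (simp add: \<delta>_def add_pos_nonneg)
  have "tends (\<lambda>x. num x * c) (s * b * c) F" "tends (\<lambda>x. den x * c) (b * c) F"
    by (intro tends_mult assms(1,2) tends_const)+
  then have "tends (\<lambda>x. num x * c) s F" "tends (\<lambda>x. den x * c) 1 F"
    using assms(3) by (simp_all add: mult.assoc)
  then have "\<forall>\<^sub>F x in F. nrm (num x * c - s) < \<delta>" "\<forall>\<^sub>F x in F. nrm (den x * c - 1) < \<delta>"
    "\<forall>\<^sub>F x in F. nrm (den x * c - 1) < 1/2"
    using \<delta> unfolding tends_iff by (auto dest: spec[of _ "1/2"])
  then show ?thesis
  proof eventually_elim
    case (elim x)
    define y where "y = 1 - den x * c"
    have y: "nrm y < \<delta>" "nrm y < 1 / 2"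
      using elim(2,3) by (simp_all add: y_def nrm_minus_commute)
    then obtain t where t: "(1 - y) * t = 1" "nrm t \<le> nrm 1 / (1 - nrm y)"
      using geometric_inverse[of y] by auto
    have "nrm 1 / (1 - nrm y) \<le> nrm 1 / (1 / 2)"
      using y nrm_one_pos by (intro divide_left_mono) auto
    with t(2) have t2: "nrm t \<le> 2 * nrm 1" by simp
    \<comment> \<open>The last summand is zero; adding it replaces \<open>s\<close> by
      \<open>s * (1 - y) * t\<close>, so that \<open>t\<close> can be factored out.\<close>
    have "num x * (c * t) - s = t * ((num x * c - s) + s * y) + s * ((1 - y) * t - 1)"
      by (simp add: algebra_simps)
    also have "\<dots> = t * ((num x * c - s) + s * y)"
      by (simp add: t(1))
    also have "nrm \<dots> \<le> nrm t * (nrm (num x * c - s) + nrm s * nrm y)"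
      by (intro order_trans[OF nrm_mult] mult_left_mono order_trans[OF nrm_triangle] add_left_mono nrm_mult) simp
    also have "\<dots> \<le> (2 * nrm 1) * (nrm (num x * c - s) + nrm s * nrm y)"
      using t2 by (intro mult_right_mono) (auto intro: add_nonneg_nonneg)
    also have "\<dots> < (2 * nrm 1) * (\<delta> + nrm s * \<delta>)"
      using elim(1) y nrm_one_pos
      by (intro mult_strict_left_mono add_less_le_mono mult_left_mono) auto
    also have "\<dots> = (2 * nrm 1 * (1 + nrm s)) * \<delta>"
      by (simp add: algebra_simps)
    also have "\<dots> = \<epsilon>"
      unfolding \<delta>_def using nrm_one_pos nrm_nonneg[of s] by (simp add: add_nonneg_eq_0_iff)
    finally have "nrm (num x * (c * t) - s) < \<epsilon>" .
    moreover have "den x * (c * t) = 1"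
      using t(1) by (simp add: y_def mult.assoc)
    ultimately show ?case by blast
  qed
qed

end

section \<open>Values of power series inside the radius of convergence\<close>

context complete_normed_ring
begin

text \<open>Mertens' theorem on Cauchy products. With \<open>c\<close> the partial sums of
  \<open>g\<close>, the sum of the \<open>b i * c (n - i)\<close> is a partial sum of the product
  series. It tends to \<beta>\<gamma>, but grouped by total degree it equals 1 for every
  \<open>n\<close>.\<close>

lemma partial_sums_tend_to_unit:
  fixes b g :: "nat \<Rightarrow> 'r"
  assumes b: "(\<lambda>i. nrm (b i)) summable_on UNIV" and g: "(\<lambda>i. nrm (g i)) summable_on UNIV"
    and inverse: "\<And>n. (\<Sum>i\<le>n. b i * g (n - i)) = (if n = 0 then 1 else 0)"
  obtains \<beta> \<gamma> where "tends (\<lambda>n. \<Sum>i\<le>n. b i) \<beta> sequentially" "\<beta> * \<gamma> = 1"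
proof -
  define c where "c n = (\<Sum>i\<le>n. g i)" for n
  obtain \<beta> where \<beta>: "tends (sum b) \<beta> (finite_subsets_at_top UNIV)"
    using summable_tends[OF b] .
  obtain \<gamma> where \<gamma>: "tends (sum g) \<gamma> (finite_subsets_at_top UNIV)"
    using summable_tends[OF g] .
  have c: "tends c \<gamma> sequentially"
    unfolding c_def by (rule tends_compose[OF \<gamma> filterlim_atMost_at_top])
  then obtain C where "\<And>n. nrm (c n) \<le> C"
    using tends_bounded by blast
  then have "tends (\<lambda>n. \<Sum>i\<le>n. b i * c (n - i)) (\<beta> * \<gamma>) sequentially"
    using c by (intro tends_weighted_sum[OF b \<beta> filterlim_atMost_at_top]
        tends_compose[OF c filterlim_minus_const_nat_at_top])
  moreover have "(\<Sum>i\<le>n. b i * c (n - i)) = 1" for n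
  proof -
    have "(\<Sum>i\<le>n. b i * c (n - i)) = (\<Sum>(i, j)\<in>{(i, j). i + j \<le> n}. b i * g j)"
    proof -
      have "{(i, j). i + j \<le> n} = Sigma {..n} (\<lambda>i. {..n - i})" by auto
      then show ?thesis
        by (simp add: c_def sum_distrib_left sum.Sigma)
    qed
    also have "\<dots> = (\<Sum>k\<le>n. \<Sum>i\<le>k. b i * g (k - i))"
      by (rule sum.triangle_reindex_eq)
    finally show ?thesis
      by (simp add: inverse)
  qed
  ultimately have "\<beta> * \<gamma> = 1"
    using tends_unique[OF _ tends_const] by fastforce
  then show ?thesis
    using that tends_compose[OF \<beta> filterlim_atMost_at_top] by blast
qed

text \<open>The root test: strict inequality leaves room for a number \<open>s\<close> above the
  limit superior with \<open>s * q < 1\<close>, and the terms are eventually dominated by a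
  geometric series.\<close>

lemma summable_at_radius:
  fixes \<phi> :: "'k::field mk \<Rightarrow> 'r" and a :: "(unit \<Rightarrow> nat) \<Rightarrow> 'k mk"
  assumes "radius \<phi> nrm a > ereal (nrm u)"
  shows "(\<lambda>n. nrm (\<phi> (a (\<lambda>_. n)) * u ^ n)) summable_on UNIV"
proof -
  define q where "q = nrm u"
  let ?r = "\<lambda>d :: unit \<Rightarrow> nat. ereal (root (\<Sum>i\<in>UNIV. d i) (nrm (\<phi> (a d))))"
  define L where "L = Limsup cofinite ?r"
  have q: "q \<ge> 0" "1 / L > ereal q"
    using assms by (simp_all add: q_def L_def radius_def)
  have inj: "inj (\<lambda>n (_::unit). n :: nat)"
    by (auto simp: inj_def dest: fun_cong)
  then have "infinite (UNIV :: (unit \<Rightarrow> nat) set)"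
    by (rule infinite_super[OF subset_UNIV range_inj_infinite])
  then have "L \<ge> 0"
    unfolding L_def by (intro le_Limsup) (auto simp: cofinite_bot real_root_ge_zero)
  moreover have "L \<noteq> \<infinity>"
    using q by auto
  ultimately obtain l where l: "L = ereal l" "l \<ge> 0"
    by (cases L) auto
  have lq: "l * q < 1"
  \<comment> \<open>In \<open>ereal\<close> the quotient 1 / 0 is infinite, so only a nonzero
    \<open>l\<close> has a real reciprocal to compare with \<open>q\<close>.\<close>
  proof (cases "l = 0")
    case False
    then have "1 / L = ereal (1 / l)"
      by (simp add: l(1) one_ereal_def)
    then have "q < 1 / l"
      using q(2) by simp
    then show ?thesis
      using False l(2) by (simp add: pos_less_divide_eq mult.commute)
  qed simp
  \<comment> \<open>A midpoint of \<open>l\<close> and 1/q would fail for \<open>q = 0\<close>.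
    Dividing the slack \<open>1 - l * q\<close> by \<open>q + 1\<close> works in all cases, since
    multiplying back by \<open>q\<close> recovers less than the whole slack.\<close>
  define s where "s = l + (1 - l * q) / (q + 1)"
  have s: "l < s" "0 < s"
    using lq q(1) l(2) by (auto simp: s_def add_nonneg_pos)
  have "s * q = l * q + (1 - l * q) * (q / (q + 1))"
    by (simp add: s_def algebra_simps add_divide_distrib diff_divide_distrib)
  also have "\<dots> < l * q + (1 - l * q) * 1"
    using lq q(1) by (intro add_strict_left_mono mult_strict_left_mono) auto
  finally have sq: "s * q < 1" by simp
  have "\<forall>\<^sub>F d in cofinite. ?r d < ereal s"
    using s l by (intro Limsup_lessD) (simp add: L_def[symmetric])
  then have "finite ((\<lambda>n (_::unit). n) -` {d. \<not> ?r d < ereal s})"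
    using inj by (intro finite_vimageI) (simp_all add: eventually_cofinite)
  then have "\<forall>\<^sub>F n in cofinite. root n (nrm (\<phi> (a (\<lambda>_. n)))) < s"
    by (simp add: eventually_cofinite vimage_def)
  then obtain N where N: "\<And>n. n \<ge> N \<Longrightarrow> root n (nrm (\<phi> (a (\<lambda>_. n)))) < s"
    by (auto simp: cofinite_eq_sequentially eventually_sequentially)
  have "summable (\<lambda>n. nrm 1 * (s * q) ^ n)"
    using sq s q by (intro summable_mult summable_geometric) simp
  then have "summable (\<lambda>n. nrm (\<phi> (a (\<lambda>_. n)) * u ^ n))"
  \<comment> \<open>The index 0 is excluded because \<open>root 0\<close> is constantly zero, so a
    power of the root does not give the number back.\<close>
  proof (rule summable_comparison_test'[of _ "max N 1"])
    fix n assume n: "max N 1 \<le> n"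
    let ?x = "nrm (\<phi> (a (\<lambda>_. n)))"
    have "?x = root n ?x ^ n"
      using n by (simp add: real_root_pow_pos2)
    also have "\<dots> \<le> s ^ n"
      using N[of n] n by (intro power_mono) (auto simp: real_root_ge_zero)
    finally have "?x \<le> s ^ n" .
    then have "nrm (\<phi> (a (\<lambda>_. n)) * u ^ n) \<le> s ^ n * (nrm 1 * q ^ n)"
      unfolding q_def using s by (intro order_trans[OF nrm_mult] mult_mono nrm_power) auto
    then show "norm (nrm (\<phi> (a (\<lambda>_. n)) * u ^ n)) \<le> nrm 1 * (s * q) ^ n"
      by (simp add: power_mult_distrib mult_ac)
  qed
  then show ?thesis
    by (subst summable_on_UNIV_nonneg_real_iff) auto
qed

end

section \<open>The limit of the quotients\<close>

lemma sum_below_unit: "(\<Sum>e\<in>below (\<lambda>_::unit. n). f e) = (\<Sum>j\<le>n. f (\<lambda>_. j))"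
proof (rule sum.reindex_bij_witness[where i = "\<lambda>j _. j" and j = "\<lambda>e. e ()"])
qed auto

text \<open>Multiplication by 1 - L^m t turns coefficients into differences, and evaluation at
  \<open>u\<close>, the inverse of the image of L^m, makes these telescope. Weak rationality is
  exactly what \<open>partial_sums_tend_to_unit\<close> asks of the series and its inverse.\<close>

lemma weakly_rational_tends:
  fixes \<phi> :: "'k::field mk \<Rightarrow> 'r::comm_ring_1" and z :: "nat \<Rightarrow> 'k mk" and m :: nat
  defines "u \<equiv> \<phi> lefschetz_inv ^ m"
  assumes \<phi>: "normed_motivic_measure \<phi> nrm"
    and z: "\<And>j. z j \<in> carrier MK"
    and rational: "weakly_rational \<phi> nrm m z"
  obtains \<beta> \<gamma> where
    "complete_normed_ring.tends nrm (\<lambda>n. \<phi> (z n) * u ^ n) \<beta> sequentially" "\<beta> * \<gamma> = 1"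
proof -
  interpret complete_normed_ring nrm
    using \<phi> by unfold_locales (simp add: normed_motivic_measure_def)
  interpret MK: cring "MK :: 'k mk ring" by (rule cring_MK)
  let ?P = "power_series_ring MK :: ((unit \<Rightarrow> nat) \<Rightarrow> 'k mk) ring"
  have hom: "\<phi> \<in> ring_hom MK ring_of_type_algebra"
    using \<phi> by (simp add: normed_motivic_measure_def motivic_measure_def)
  note hom_simps = hom_simps[OF cring_MK hom] hom_zero[OF cring_MK hom] hom_uminus[OF cring_MK hom]
    hom_pow[OF cring_MK hom]
  define lin where "lin j = (if j = 0 then \<one>\<^bsub>MK\<^esub>
      else if j = 1 then \<ominus>\<^bsub>MK\<^esub> (lefschetz [^]\<^bsub>MK\<^esub> m) else \<zero>\<^bsub>MK\<^esub> :: 'k mk)" for j :: nat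
  define B where "B = series_in MK () lin \<otimes>\<^bsub>?P\<^esub> series_in MK () z"
  obtain G where G: "G \<in> carrier ?P" "B \<otimes>\<^bsub>?P\<^esub> G = \<one>\<^bsub>?P\<^esub>"
    and radius: "radius \<phi> nrm B > ereal (nrm u)" "radius \<phi> nrm G > ereal (nrm u)"
    using rational unfolding weakly_rational_def Let_def u_def B_def lin_def by blast
  have L: "lefschetz \<in> carrier (MK :: 'k mk ring)"
    by (simp add: lefschetz_def mk_class_in_carrier)
  have lin: "lin j \<in> carrier MK" for j
    using L by (simp add: lin_def)
  have series: "series_in MK () f d \<in> carrier MK" if "\<And>j. f j \<in> carrier MK" for f :: "nat \<Rightarrow> 'k mk" and d
    using that by (simp add: series_in_def)
  define v where "v = \<phi> lefschetz ^ m"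
  have "\<phi> lefschetz * \<phi> lefschetz_inv = 1"
    using hom_simps(1)[OF L lefschetz_inverse(1)] by (simp add: lefschetz_inverse(2) hom_simps)
  then have vu: "v * u = 1"
    by (simp add: v_def u_def flip: power_mult_distrib)
  have B: "\<phi> (B (\<lambda>_. n)) = (\<Sum>j\<le>n. \<phi> (lin j) * \<phi> (z (n - j)))" for n
    unfolding B_def hom_power_series_mult[OF cring_MK hom series[OF lin] series[OF z]] sum_below_unit
    by (simp add: series_in_def)
  have B_0: "\<phi> (B (\<lambda>_. 0)) = \<phi> (z 0)"
    by (simp add: B lin_def hom_simps)
  \<comment> \<open>The linear factor has coefficients in degrees 0 and 1 only, so just two terms of
    the convolution remain.\<close>
  have B_Suc: "\<phi> (B (\<lambda>_. Suc n)) = \<phi> (z (Suc n)) - v * \<phi> (z n)" for n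
  proof -
    have "\<phi> (lin (Suc j)) * \<phi> (z (n - j)) = (if j = 0 then - v * \<phi> (z n) else 0)" for j
      using L by (simp add: lin_def hom_simps v_def)
    then have "(\<Sum>j\<le>n. \<phi> (lin (Suc j)) * \<phi> (z (n - j))) = - v * \<phi> (z n)"
      by simp
    then show ?thesis
      unfolding B by (subst sum.atMost_Suc_shift) (simp add: lin_def hom_simps)
  qed
  define b where "b n = \<phi> (B (\<lambda>_. n)) * u ^ n" for n
  define g where "g n = \<phi> (G (\<lambda>_. n)) * u ^ n" for n
  have partial: "(\<Sum>i\<le>n. b i) = \<phi> (z n) * u ^ n" for n
  proof (induction n)
    case (Suc n)
    \<comment> \<open>The spare power of \<open>u\<close> cancels \<open>v\<close>, leaving the
      previous partial sum to be subtracted.\<close>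
    have "v * \<phi> (z n) * u ^ Suc n = \<phi> (z n) * u ^ n * (v * u)"
      by (simp add: mult_ac)
    then have "b (Suc n) = \<phi> (z (Suc n)) * u ^ Suc n - \<phi> (z n) * u ^ n"
      by (simp only: b_def B_Suc vu left_diff_distrib mult_1_right)
    then show ?case
      by (simp add: Suc.IH)
  qed (simp add: b_def B_0)
  have "(\<Sum>i\<le>n. b i * g (n - i)) = (if n = 0 then 1 else 0)" for n
  proof -
    have "(\<Sum>i\<le>n. b i * g (n - i))
        = (\<Sum>i\<le>n. \<phi> (B (\<lambda>_. i)) * \<phi> (G (\<lambda>_. n - i)) * u ^ n)"
    proof (intro sum.cong refl)
      fix i assume i: "i \<in> {..n}"
      have "b i * g (n - i) = \<phi> (B (\<lambda>_. i)) * \<phi> (G (\<lambda>_. n - i)) * (u ^ i * u ^ (n - i))"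
        by (simp add: b_def g_def mult_ac)
      with i show "b i * g (n - i) = \<phi> (B (\<lambda>_. i)) * \<phi> (G (\<lambda>_. n - i)) * u ^ n"
        by (simp flip: power_add)
    qed
    also have "\<dots> = (\<Sum>e\<in>below (\<lambda>_. n). \<phi> (B e) * \<phi> (G (\<lambda>i. n - e i))) * u ^ n"
      by (simp only: sum_below_unit sum_distrib_right)
    also have "(\<Sum>e\<in>below (\<lambda>_. n). \<phi> (B e) * \<phi> (G (\<lambda>i. n - e i))) = \<phi> ((B \<otimes>\<^bsub>?P\<^esub> G) (\<lambda>_. n))"
    proof (subst hom_power_series_mult[OF cring_MK hom])
      show "B d \<in> carrier MK" for d
        unfolding B_def by (intro power_series_mult_closed[OF cring_MK] series lin z)
      show "G d \<in> carrier MK" for d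
        using G(1) by (simp add: power_series_ring_def)
    qed simp
    also have "\<dots> * u ^ n = (if n = 0 then 1 else 0)"
      by (simp add: G(2)) (simp add: power_series_ring_def hom_simps)
    finally show ?thesis .
  qed
  then obtain \<beta> \<gamma> where "tends (\<lambda>n. \<Sum>i\<le>n. b i) \<beta> sequentially" "\<beta> * \<gamma> = 1"
    using partial_sums_tend_to_unit[of b g] summable_at_radius[OF radius(1)] summable_at_radius[OF radius(2)]
    unfolding b_def g_def by blast
  then show ?thesis
    using that by (simp add: partial)
qed

text \<open>All entries are large exactly if the smallest is. Having this mode of convergence as a
  filter makes the general facts on \<open>tends\<close> applicable to it.\<close>

definition entries_at_top :: "('n::finite \<Rightarrow> nat) filter" where
  "entries_at_top = filtercomap (\<lambda>d. Min (range d)) at_top"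

lemma eventually_entries_at_top:
  "eventually P entries_at_top \<longleftrightarrow> (\<exists>N. \<forall>d :: 'n::finite \<Rightarrow> nat. (\<forall>i. N \<le> d i) \<longrightarrow> P d)"
  by (simp add: entries_at_top_def eventually_filtercomap_at_top_linorder)

lemma filterlim_entry_diff:
  "filterlim (\<lambda>d :: 'n::finite \<Rightarrow> nat. d i - k) at_top entries_at_top"
  unfolding filterlim_at_top eventually_entries_at_top
proof
  fix Z
  show "\<exists>N. \<forall>d :: 'n \<Rightarrow> nat. (\<forall>j. N \<le> d j) \<longrightarrow> Z \<le> d i - k"
    by (rule exI[of _ "Z + k"]) (auto intro: add_le_imp_le_diff)
qed

text \<open>The range of summation of a convolution eventually contains any given finite set, as
  \<open>tends_weighted_sum\<close> demands.\<close>

lemma filterlim_below: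
  "filterlim below (finite_subsets_at_top UNIV) (entries_at_top :: ('n::finite \<Rightarrow> nat) filter)"
proof (rule filterlim_finite_subsets_at_top[THEN iffD2], intro allI impI)
  fix E :: "('n \<Rightarrow> nat) set"
  assume E: "finite E \<and> E \<subseteq> UNIV"
  \<comment> \<open>A crude common bound for all entries of all elements of
    \<open>E\<close>.\<close>
  define N where "N = (\<Sum>e\<in>E. \<Sum>i\<in>UNIV. e i)"
  have "e i \<le> N" if "e \<in> E" for e i
  proof -
    have "e i \<le> (\<Sum>i\<in>UNIV. e i)" by (rule member_le_sum) auto
    also have "\<dots> \<le> N" unfolding N_def using that E by (intro member_le_sum) auto
    finally show ?thesis .
  qed
  then show "\<forall>\<^sub>F d in entries_at_top. finite (below d) \<and> E \<subseteq> below d \<and> below d \<subseteq> UNIV"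
    unfolding eventually_entries_at_top by (intro exI[of _ N]) (auto simp: finite_below intro: order_trans)
qed

theorem theorem4p3p3:
  fixes X :: "'k::field uspace"
    and A :: "('n::finite \<Rightarrow> nat) set"
    and \<phi> :: "'k mk \<Rightarrow> 'r::comm_ring_1"
    and nrm :: "'r \<Rightarrow> real"
    and SymX :: "nat \<Rightarrow> 'k uspace"
    and SymVX :: "('n \<Rightarrow> nat) \<Rightarrow> 'k uspace"
    and XA :: "('n \<Rightarrow> nat) \<Rightarrow> 'k uspace"
    and F :: "('n \<Rightarrow> nat) \<Rightarrow> 'k mk"
    and \<zeta> :: 'r
  assumes "variety X" and "irreducible_space X" and "quasi_projective X"
    and "(\<lambda>_. 0) \<notin> A" and "\<And>i. (\<lambda>j. if j = i then 1 else 0) \<in> A"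
    and "normed_motivic_measure \<phi> nrm"
    and "\<And>j. is_symmetric_power X j (SymX j)"
    and "\<And>d. variety (SymVX d) \<and> (\<exists>pr. is_product UNIV (\<lambda>i. SymX (d i)) (SymVX d) pr)"
    and "\<And>d. is_config_space X A d (XA d)"
    and "weakly_rational \<phi> nrm (krull_dim X) (\<lambda>j. mk_class (SymX j))"
    and "F \<in> carrier (power_series_ring MK)"
    and "F \<otimes>\<^bsub>power_series_ring MK\<^esub>
           (\<Otimes>\<^bsub>power_series_ring MK\<^esub>i\<in>UNIV. series_in MK i (\<lambda>j. mk_class (SymX j)))
         = (\<lambda>d. mk_class (XA d))"
    and "converges_absolutely_to nrm
           (\<lambda>d. \<phi> (F d) * (\<Prod>i\<in>UNIV. (\<phi> lefschetz_inv ^ krull_dim X) ^ d i)) \<zeta>"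
  shows "quotients_tend_to nrm (\<lambda>d. \<phi> (mk_class (XA d))) (\<lambda>d. \<phi> (mk_class (SymVX d))) \<zeta>"
proof -
  interpret complete_normed_ring nrm
    using assms(6) by unfold_locales (simp add: normed_motivic_measure_def)
  interpret MK: cring "MK :: 'k mk ring" by (rule cring_MK)
  interpret P: comm_monoid "power_series_ring MK :: (('n \<Rightarrow> nat) \<Rightarrow> 'k mk) ring"
    by (rule comm_monoid_power_series_ring[OF cring_MK])
  have motivic: "motivic_measure \<phi>"
    using assms(6) by (simp add: normed_motivic_measure_def)
  then have hom: "\<phi> \<in> ring_hom MK ring_of_type_algebra"
    by (simp add: motivic_measure_def)
  define u where "u = \<phi> lefschetz_inv ^ krull_dim X"
  \<comment> \<open>The weight u^|d|, applied to numerator and denominator alike; with it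
    \<open>f\<close> lists the terms of the series for \<zeta>.\<close>
  define U where "U d = (\<Prod>i\<in>UNIV. u ^ d i)" for d :: "'n \<Rightarrow> nat"
  define z where "z j = (mk_class (SymX j) :: 'k mk)" for j
  define y where "y n = \<phi> (z n) * u ^ n" for n
  define f where "f d = \<phi> (F d) * U d" for d
  have z: "z j \<in> carrier MK" for j
    by (simp add: z_def mk_class_in_carrier)
  obtain \<beta> \<gamma> where \<beta>: "tends y \<beta> sequentially" and \<beta>\<gamma>: "\<beta> * \<gamma> = 1"
    using weakly_rational_tends[OF assms(6), of z "krull_dim X"] z assms(10)
    unfolding y_def u_def z_def[abs_def] by blast
  obtain C where C: "\<And>n. nrm (y n) \<le> C"
    using tends_bounded[OF \<beta>] by blast
  have f: "(\<lambda>d. nrm (f d)) summable_on UNIV" "tends (sum f) \<zeta> (finite_subsets_at_top UNIV)"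
    using assms(13)
    by (auto simp: converges_absolutely_to_def f_def U_def u_def tends_iff eventually_finite_subsets_at_top)
  have den: "\<phi> (mk_class (SymVX d)) * U d = (\<Prod>i\<in>UNIV. y (d i))" for d
  proof -
    obtain pr where "is_product UNIV (\<lambda>i. SymX (d i)) (SymVX d) pr"
      using assms(8) by blast
    moreover have "variety (SymX j)" for j
      using assms(7) unfolding is_symmetric_power_def by blast
    ultimately have "\<phi> (mk_class (SymVX d)) = (\<Prod>i\<in>UNIV. \<phi> (z (d i)))"
      unfolding z_def using assms(8) by (intro motivic_measure_product[OF motivic]) auto
    then show ?thesis
      by (simp add: y_def U_def prod.distrib)
  qed
  have num: "\<phi> (mk_class (XA d)) * U d = (\<Sum>e\<in>below d. f e * (\<Prod>i\<in>UNIV. y (d i - e i)))" for d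
  proof -
    let ?Z = "\<Otimes>\<^bsub>power_series_ring MK\<^esub>i\<in>(UNIV :: 'n set). series_in MK i z"
    have F: "F e \<in> carrier MK" for e
      using assms(11) by (simp add: power_series_ring_def)
    have "?Z \<in> carrier (power_series_ring MK)"
      using z by (intro P.finprod_closed) (auto simp: power_series_ring_def series_in_def)
    then have Z: "?Z e \<in> carrier MK" for e
      by (simp add: power_series_ring_def)
    have "\<phi> (mk_class (XA d)) = \<phi> ((F \<otimes>\<^bsub>power_series_ring MK\<^esub> ?Z) d)"
      unfolding z_def using assms(12) by simp
    also have "\<dots> = (\<Sum>e\<in>below d. \<phi> (F e) * \<phi> (?Z (\<lambda>i. d i - e i)))"
      by (rule hom_power_series_mult[OF cring_MK hom F Z])
    also have "\<dots> = (\<Sum>e\<in>below d. \<phi> (F e) * (\<Prod>i\<in>UNIV. \<phi> (z (d i - e i))))"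
      by (simp add: hom_prod_series_in[OF cring_MK hom z])
    also have "\<dots> * U d = (\<Sum>e\<in>below d. f e * (\<Prod>i\<in>UNIV. y (d i - e i)))"
      unfolding sum_distrib_right
    proof (intro sum.cong refl)
      fix e assume e: "e \<in> below d"
      \<comment> \<open>The weight is shared out between the two factors of the convolution, which
        uses that \<open>e\<close> lies below \<open>d\<close>.\<close>
      have "U d = (\<Prod>i\<in>UNIV. u ^ e i * u ^ (d i - e i))"
        unfolding U_def using e by (simp flip: power_add)
      then show "\<phi> (F e) * (\<Prod>i\<in>UNIV. \<phi> (z (d i - e i))) * U d = f e * (\<Prod>i\<in>UNIV. y (d i - e i))"
        by (simp add: f_def U_def y_def prod.distrib mult_ac)
    qed
    finally show ?thesis .
  qed
  \<comment> \<open>For fixed \<open>e\<close> every difference \<open>d i - e i\<close> still tends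
    to infinity, so the limit does not depend on \<open>e\<close>.\<close>
  have y_lim: "tends (\<lambda>d :: 'n \<Rightarrow> nat. \<Prod>i\<in>UNIV. y (d i - e i)) (\<beta> ^ CARD('n)) entries_at_top"
    for e :: "'n \<Rightarrow> nat"
  proof -
    have "tends (\<lambda>d :: 'n \<Rightarrow> nat. \<Prod>i\<in>UNIV. y (d i - e i)) (\<Prod>i\<in>(UNIV :: 'n set). \<beta>) entries_at_top"
      by (intro tends_prod tends_compose[OF \<beta>] filterlim_entry_diff)
    then show ?thesis by simp
  qed
  \<comment> \<open>The bound is uniform in \<open>d\<close> and \<open>e\<close>, as dominated
    convergence requires; it comes from the boundedness of the convergent sequence
    \<open>y\<close>.\<close>
  have "nrm (\<Prod>i\<in>UNIV. y (d i - e i)) \<le> nrm 1 * C ^ CARD('n)" for d e :: "'n \<Rightarrow> nat"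
  proof -
    have "(\<Prod>i\<in>UNIV. nrm (y (d i - e i))) \<le> (\<Prod>i\<in>(UNIV :: 'n set). C)"
      using C by (intro prod_mono) auto
    then show ?thesis
      by (intro order_trans[OF nrm_prod] mult_left_mono) auto
  qed
  then have "tends (\<lambda>d. \<Sum>e\<in>below d. f e * (\<Prod>i\<in>UNIV. y (d i - e i))) (\<zeta> * \<beta> ^ CARD('n)) entries_at_top"
    by (intro tends_weighted_sum[OF f filterlim_below y_lim])
  moreover have "tends (\<lambda>d :: 'n \<Rightarrow> nat. \<Prod>i\<in>UNIV. y (d i)) (\<beta> ^ CARD('n)) entries_at_top"
    using y_lim[of "\<lambda>_. 0"] by simp
  moreover have "\<beta> ^ CARD('n) * \<gamma> ^ CARD('n) = 1"
    using \<beta>\<gamma> by (simp flip: power_mult_distrib)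
  ultimately have quotient: "\<forall>\<^sub>F d in entries_at_top. \<exists>r. \<phi> (mk_class (SymVX d)) * U d * r = 1 \<and>
      nrm (\<phi> (mk_class (XA d)) * U d * r - \<zeta>) < \<epsilon>" if "\<epsilon> > 0" for \<epsilon>
    unfolding den num by (rule tends_quotient[OF _ _ _ that])
  show ?thesis
    unfolding quotients_tend_to_def
  proof (intro allI impI)
    fix \<epsilon> :: real assume "\<epsilon> > 0"
    from quotient[OF this] show "\<exists>N. \<forall>d. (\<forall>i. d i \<ge> N) \<longrightarrow>
        (\<exists>r. \<phi> (mk_class (SymVX d)) * r = 1 \<and> nrm (\<phi> (mk_class (XA d)) * r - \<zeta>) < \<epsilon>)"
      \<comment> \<open>If \<open>r\<close> inverts the weighted denominator, then
        \<open>U d * r\<close> inverts the denominator itself and yields the same quotient.\<close>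
      unfolding eventually_entries_at_top mult.assoc by blast
  qed
qed

end
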